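(* Let $F$ be a field of characteristic $0$, let $H$ be a Hopf algebra over $F$ with an $\mathrm{ad}$-invariant left integral $t\in H^*$ such that $t(1)=1$, let $L$ be an $H$-comodule Lie algebra over $F$, and let $(V,\psi)$ be a finite dimensional $(H,L)$-module that is completely reducible as an $L$-module disregarding the $H$-coaction. Then $V=V_1\oplus V_2\oplus\dots\oplus V_s$ for some irreducible $(H,L)$-submodules $V_i$.
   Context: Here $H$ may be infinite dimensional, $H^*=\mathrm{Hom}_F(H,F)$, and Sweedler notation is used: $\Delta(a)=a_{(1)}\otimes a_{(2)}$ for the comultiplication; $\varepsilon$ and $S$ are the counit and antipode of $H$. An element $t\in H^*$ is a left integral on $H$ if $t(a_{(2)})a_{(1)}=t(a)1$ for all $a\in H$. A left integral $t$ is $\mathrm{ad}$-invariant if $t(a_{(1)}\,b\,S(a_{(2)}))=\varepsilon(a)t(b)$ for all $a,b\in H$. All comodules are right comodules, with coaction written $\rho(v)=v_{(0)}\otimes v_{(1)}$. A Lie algebra $L$ that is an $H$-comodule is an $H$-comodule Lie algebra if $\rho([a,b])=[a_{(0)},b_{(0)}]\otimes a_{(1)}b_{(1)}$ for all $a,b\in L$. Given a representation $\psi\colon L\to\mathfrak{gl}(V)$, the pair $(V,\psi)$ is an $(H,L)$-module if $V$ is an $H$-comodule with comodule map $\rho_V\colon V\to V\otimes H$ and $\rho_V(\psi(a)v)=\psi(a_{(0)})v_{(0)}\otimes a_{(1)}v_{(1)}$ for all $a\in L$, $v\in V$. An $(H,L)$-submodule is an $L$-submodule that is also an $H$-subcomodule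 (a subspace $W$ with $\rho_V(W)\subseteq W\otimes H$). An $(H,L)$-module is irreducible if it has no nontrivial $L$-submodules that are $H$-subcomodules at the same time. *)

theory Defs
  imports "HOL-Library.Poly_Mapping" Complex_Main
begin

section \<open>Free vector spaces and tensor products\<close>

text \<open>
  The type \<open>'k \<Rightarrow>\<^sub>0 'f\<close> is the vector space over \<open>'f\<close> with basis \<open>'k\<close>, the basis vector of \<open>k\<close>
  being \<open>Poly_Mapping.single k 1\<close>. Vector spaces are whole types (additive groups) with an explicit
  scalar multiplication.
\<close>

definition fscale :: "'f::field \<Rightarrow> ('k \<Rightarrow>\<^sub>0 'f) \<Rightarrow> ('k \<Rightarrow>\<^sub>0 'f)" where
  "fscale c p = Poly_Mapping.map ((*) c) p"

lemma lookup_fscale [simp]: "Poly_Mapping.lookup (fscale c p) k = c * Poly_Mapping.lookup p k"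
  by (simp add: fscale_def Poly_Mapping.map.rep_eq when_def)

interpretation free: vector_space fscale
  by unfold_locales (auto intro!: poly_mapping_eqI simp: lookup_add algebra_simps)

text \<open>
  \<open>lin_ext s g p\<close> is the value at \<open>p\<close> of the linear map that sends the basis vector of \<open>k\<close>
  to \<open>g k\<close>; here \<open>s\<close> is the scalar multiplication of the target space.
\<close>

definition lin_ext :: "('f::zero \<Rightarrow> 'm \<Rightarrow> 'm) \<Rightarrow> ('k \<Rightarrow> 'm::comm_monoid_add) \<Rightarrow> ('k \<Rightarrow>\<^sub>0 'f) \<Rightarrow> 'm" where
  "lin_ext s g p = (\<Sum>k\<in>Poly_Mapping.keys p. s (Poly_Mapping.lookup p k) (g k))"

text \<open>
  The subspaces of multilinearity relations: the tensor product of two (three) spaces is the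
  quotient of the free vector space on pairs (triples) by \<open>tensor_null\<close> (\<open>tensor_null3\<close>).
\<close>

definition tensor_null ::
    "('f::field \<Rightarrow> 'a::ab_group_add \<Rightarrow> 'a) \<Rightarrow> ('f \<Rightarrow> 'b::ab_group_add \<Rightarrow> 'b) \<Rightarrow> ('a \<times> 'b \<Rightarrow>\<^sub>0 'f) set" where
  "tensor_null sA sB = module.span fscale (
     {Poly_Mapping.single (x + x', y) 1 - Poly_Mapping.single (x, y) 1 - Poly_Mapping.single (x', y) 1
        | x x' y. True} \<union>
     {Poly_Mapping.single (x, y + y') 1 - Poly_Mapping.single (x, y) 1 - Poly_Mapping.single (x, y') 1
        | x y y'. True} \<union>
     {Poly_Mapping.single (sA c x, y) 1 - fscale c (Poly_Mapping.single (x, y) 1) | c x y. True} \<union>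
     {Poly_Mapping.single (x, sB c y) 1 - fscale c (Poly_Mapping.single (x, y) 1) | c x y. True})"

definition tensor_null3 ::
    "('f::field \<Rightarrow> 'a::ab_group_add \<Rightarrow> 'a) \<Rightarrow> ('f \<Rightarrow> 'b::ab_group_add \<Rightarrow> 'b) \<Rightarrow>
     ('f \<Rightarrow> 'c::ab_group_add \<Rightarrow> 'c) \<Rightarrow> ('a \<times> 'b \<times> 'c \<Rightarrow>\<^sub>0 'f) set" where
  "tensor_null3 sA sB sC = module.span fscale (
     {Poly_Mapping.single (x + x', y, z) 1 - Poly_Mapping.single (x, y, z) 1
        - Poly_Mapping.single (x', y, z) 1 | x x' y z. True} \<union>
     {Poly_Mapping.single (x, y + y', z) 1 - Poly_Mapping.single (x, y, z) 1
        - Poly_Mapping.single (x, y', z) 1 | x y y' z. True} \<union>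
     {Poly_Mapping.single (x, y, z + z') 1 - Poly_Mapping.single (x, y, z) 1
        - Poly_Mapping.single (x, y, z') 1 | x y z z'. True} \<union>
     {Poly_Mapping.single (sA c x, y, z) 1 - fscale c (Poly_Mapping.single (x, y, z) 1) | c x y z. True} \<union>
     {Poly_Mapping.single (x, sB c y, z) 1 - fscale c (Poly_Mapping.single (x, y, z) 1) | c x y z. True} \<union>
     {Poly_Mapping.single (x, y, sC c z) 1 - fscale c (Poly_Mapping.single (x, y, z) 1) | c x y z. True})"

text \<open>The coset of \<open>p\<close> modulo a subspace \<open>N\<close>, an element of the quotient space.\<close>

definition coset_of :: "'a::ab_group_add set \<Rightarrow> 'a \<Rightarrow> 'a set" where
  "coset_of N p = {q. q - p \<in> N}"

definition tensor_space ::
    "('f::field \<Rightarrow> 'a::ab_group_add \<Rightarrow> 'a) \<Rightarrow> ('f \<Rightarrow> 'b::ab_group_add \<Rightarrow> 'b) \<Rightarrow> ('a \<times> 'b \<Rightarrow>\<^sub>0 'f) set set" where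
  "tensor_space sA sB = range (coset_of (tensor_null sA sB))"

text \<open>
  Hence \<open>p \<in> \<Delta> a\<close> says that \<open>p\<close>, read as the sum of \<open>lookup p (x, y)\<close> times \<open>x \<otimes> y\<close>,
  is one of the expressions for \<open>\<Delta>(a)\<close>. A formula in Sweedler notation that is multilinear in
  \<open>a\<^sub>(\<^sub>1\<^sub>)\<close> and \<open>a\<^sub>(\<^sub>2\<^sub>)\<close> becomes a \<open>lin_ext\<close> over an arbitrary such \<open>p\<close>; by \<open>lin_ext_tensor_well_defined\<close> its
  value does not depend on the choice of \<open>p\<close>.
\<close>

lemma lin_ext_superset:
  assumes "vector_space s" "finite K" "Poly_Mapping.keys p \<subseteq> K"
  shows "lin_ext s g p = (\<Sum>k\<in>K. s (Poly_Mapping.lookup p k) (g k))"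
proof -
  interpret vector_space s by fact
  show ?thesis unfolding lin_ext_def
    by (rule sum.mono_neutral_left) (use assms(2,3) in \<open>auto simp: in_keys_iff\<close>)
qed

lemma linear_lin_ext:
  assumes "vector_space s"
  shows "Vector_Spaces.linear fscale s (lin_ext s g)"
proof -
  interpret vector_space s by fact
  have add: "lin_ext s g (p + q) = lin_ext s g p + lin_ext s g q" for p q
  proof -
    let ?K = "Poly_Mapping.keys p \<union> Poly_Mapping.keys q"
    have "Poly_Mapping.keys (p + q) \<subseteq> ?K" by (rule keys_add)
    then show ?thesis
      by (simp add: lin_ext_superset[OF assms, of ?K] lookup_add scale_left_distrib sum.distrib)
  qed
  have scl: "lin_ext s g (fscale c p) = s c (lin_ext s g p)" for c p
  proof -
    have "Poly_Mapping.keys (fscale c p) \<subseteq> Poly_Mapping.keys p" by (auto simp: in_keys_iff)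
    then show ?thesis
      by (simp add: lin_ext_superset[OF assms, of "Poly_Mapping.keys p"] scale_sum_right)
  qed
  show ?thesis
    by (intro Vector_Spaces.linear_iff[THEN iffD2] conjI allI assms free.vector_space_axioms add scl)
qed

lemma lin_ext_single [simp]:
  assumes "vector_space s"
  shows "lin_ext s g (Poly_Mapping.single k 1) = g k"
proof -
  interpret vector_space s by fact
  show ?thesis by (simp add: lin_ext_def)
qed

lemma lin_ext_tensor_well_defined:
  assumes lin1: "\<And>y. Vector_Spaces.linear sA s (\<lambda>x. g (x, y))"
    and lin2: "\<And>x. Vector_Spaces.linear sB s (\<lambda>y. g (x, y))"
    and X: "X \<in> tensor_space sA sB" "p \<in> X" "q \<in> X"
  shows "lin_ext s g p = lin_ext s g q"
proof -
  have vs: "vector_space s" using lin1[of undefined] by (simp add: Vector_Spaces.linear_iff)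
  interpret l: Vector_Spaces.linear fscale s "lin_ext s g" by (rule linear_lin_ext[OF vs])
  have null: "lin_ext s g r = 0" if "r \<in> tensor_null sA sB" for r
    using that unfolding tensor_null_def
  proof (induction rule: free.span_induct)
    case base
    show ?case by (simp add: free.subspace_def l.add l.scale)
  next
    case (step r)
    have a1: "g (x + x', y) = g (x, y) + g (x', y)" for x x' y using lin1 by (simp add: Vector_Spaces.linear_iff)
    have a2: "g (x, y + y') = g (x, y) + g (x, y')" for x y y' using lin2 by (simp add: Vector_Spaces.linear_iff)
    have s1: "g (sA c x, y) = s c (g (x, y))" for c x y using lin1 by (simp add: Vector_Spaces.linear_iff)
    have s2: "g (x, sB c y) = s c (g (x, y))" for c x y using lin2 by (simp add: Vector_Spaces.linear_iff)
    show ?case using step by (auto simp: l.diff l.scale vs a1 a2 s1 s2)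
  qed
  obtain r where "X = coset_of (tensor_null sA sB) r" using X(1) by (auto simp: tensor_space_def)
  then have "lin_ext s g (p - r) = 0" "lin_ext s g (q - r) = 0"
    using X(2,3) by (auto simp: coset_of_def null)
  then show ?thesis by (simp add: l.diff)
qed


section \<open>Coalgebras, Hopf algebras, comodules\<close>

text \<open>
  A linear map into the tensor product. The second and third conjuncts are additivity and homogeneity with
  respect to the operations of the quotient space.
\<close>

definition tensor_linear ::
    "('f::field \<Rightarrow> 'u::ab_group_add \<Rightarrow> 'u) \<Rightarrow> ('f \<Rightarrow> 'a::ab_group_add \<Rightarrow> 'a) \<Rightarrow>
     ('f \<Rightarrow> 'b::ab_group_add \<Rightarrow> 'b) \<Rightarrow> ('u \<Rightarrow> ('a \<times> 'b \<Rightarrow>\<^sub>0 'f) set) \<Rightarrow> bool" where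
  "tensor_linear sU sA sB \<rho> \<longleftrightarrow>
     (\<forall>u. \<rho> u \<in> tensor_space sA sB) \<and>
     (\<forall>u v. \<forall>p\<in>\<rho> u. \<forall>q\<in>\<rho> v. p + q \<in> \<rho> (u + v)) \<and>
     (\<forall>c u. \<forall>p\<in>\<rho> u. fscale c p \<in> \<rho> (sU c u))"

text \<open>
  In the coassociativity axioms, \<open>d\<close> and \<open>r\<close> choose an expression for each value of \<open>\<Delta>\<close>
  and \<open>\<rho>\<close>, in order to write out \<open>(\<Delta> \<otimes> id) \<circ> \<Delta> = (id \<otimes> \<Delta>) \<circ> \<Delta>\<close> and
  \<open>(\<rho> \<otimes> id) \<circ> \<rho> = (id \<otimes> \<Delta>) \<circ> \<rho>\<close>.
\<close>

locale coalgebra = vector_space sH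
  for sH :: "'f::field \<Rightarrow> 'h::ab_group_add \<Rightarrow> 'h" +
  fixes \<Delta> :: "'h \<Rightarrow> ('h \<times> 'h \<Rightarrow>\<^sub>0 'f) set"
    and \<epsilon> :: "'h \<Rightarrow> 'f"
  assumes comult_linear: "tensor_linear sH sH sH \<Delta>"
    and counit_linear: "Vector_Spaces.linear sH (*) \<epsilon>"
    and coassoc: "\<lbrakk>\<And>x. d x \<in> \<Delta> x; p \<in> \<Delta> a\<rbrakk> \<Longrightarrow>
      coset_of (tensor_null3 sH sH sH)
        (lin_ext fscale (\<lambda>(x, y). lin_ext fscale (\<lambda>(x1, x2). Poly_Mapping.single (x1, x2, y) 1) (d x)) p) =
      coset_of (tensor_null3 sH sH sH)
        (lin_ext fscale (\<lambda>(x, y). lin_ext fscale (\<lambda>(y1, y2). Poly_Mapping.single (x, y1, y2) 1) (d y)) p)"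
    and counit_left: "p \<in> \<Delta> a \<Longrightarrow> lin_ext sH (\<lambda>(x, y). sH (\<epsilon> x) y) p = a"
    and counit_right: "p \<in> \<Delta> a \<Longrightarrow> lin_ext sH (\<lambda>(x, y). sH (\<epsilon> y) x) p = a"

locale hopf_algebra = coalgebra sH \<Delta> \<epsilon>
  for sH :: "'f::field \<Rightarrow> 'h::ring_1 \<Rightarrow> 'h" and \<Delta> \<epsilon> +
  fixes S :: "'h \<Rightarrow> 'h"
  assumes mult_scale_left: "sH c x * y = sH c (x * y)"
    and mult_scale_right: "x * sH c y = sH c (x * y)"
    and comult_one: "Poly_Mapping.single (1, 1) 1 \<in> \<Delta> 1"
    and comult_mult: "\<lbrakk>p \<in> \<Delta> a; q \<in> \<Delta> b\<rbrakk> \<Longrightarrow>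
      lin_ext fscale (\<lambda>(x1, x2). lin_ext fscale (\<lambda>(y1, y2).
        Poly_Mapping.single (x1 * y1, x2 * y2) 1) q) p \<in> \<Delta> (a * b)"
    and counit_one: "\<epsilon> 1 = 1"
    and counit_mult: "\<epsilon> (a * b) = \<epsilon> a * \<epsilon> b"
    and antipode_linear: "Vector_Spaces.linear sH sH S"
    and antipode_left: "p \<in> \<Delta> a \<Longrightarrow> lin_ext sH (\<lambda>(x, y). S x * y) p = sH (\<epsilon> a) 1"
    and antipode_right: "p \<in> \<Delta> a \<Longrightarrow> lin_ext sH (\<lambda>(x, y). x * S y) p = sH (\<epsilon> a) 1"

locale comodule = coalgebra sH \<Delta> \<epsilon> + V: vector_space sV
  for sH :: "'f::field \<Rightarrow> 'h::ab_group_add \<Rightarrow> 'h" and \<Delta> \<epsilon>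
    and sV :: "'f \<Rightarrow> 'v::ab_group_add \<Rightarrow> 'v" +
  fixes \<rho> :: "'v \<Rightarrow> ('v \<times> 'h \<Rightarrow>\<^sub>0 'f) set"
  assumes coaction_linear: "tensor_linear sV sV sH \<rho>"
    and coaction_coassoc: "\<lbrakk>\<And>u. r u \<in> \<rho> u; \<And>x. d x \<in> \<Delta> x; p \<in> \<rho> v\<rbrakk> \<Longrightarrow>
      coset_of (tensor_null3 sV sH sH)
        (lin_ext fscale (\<lambda>(u, x). lin_ext fscale (\<lambda>(u0, u1). Poly_Mapping.single (u0, u1, x) 1) (r u)) p) =
      coset_of (tensor_null3 sV sH sH)
        (lin_ext fscale (\<lambda>(u, x). lin_ext fscale (\<lambda>(x1, x2). Poly_Mapping.single (u, x1, x2) 1) (d x)) p)"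
    and coaction_counit: "p \<in> \<rho> v \<Longrightarrow> lin_ext sV (\<lambda>(u, x). sV (\<epsilon> x) u) p = v"

definition left_integral ::
    "('f::field \<Rightarrow> 'h::ring_1 \<Rightarrow> 'h) \<Rightarrow> ('h \<Rightarrow> ('h \<times> 'h \<Rightarrow>\<^sub>0 'f) set) \<Rightarrow> ('h \<Rightarrow> 'f) \<Rightarrow> bool" where
  "left_integral sH \<Delta> t \<longleftrightarrow> Vector_Spaces.linear sH (*) t \<and>
     (\<forall>a. \<forall>p\<in>\<Delta> a. lin_ext sH (\<lambda>(x, y). sH (t y) x) p = sH (t a) 1)"

definition ad_invariant ::
    "('h::ring_1 \<Rightarrow> ('h \<times> 'h \<Rightarrow>\<^sub>0 'f::field) set) \<Rightarrow> ('h \<Rightarrow> 'f) \<Rightarrow> ('h \<Rightarrow> 'h) \<Rightarrow> ('h \<Rightarrow> 'f) \<Rightarrow> bool" where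
  "ad_invariant \<Delta> \<epsilon> S t \<longleftrightarrow>
     (\<forall>a b. \<forall>p\<in>\<Delta> a. lin_ext (*) (\<lambda>(x, y). t (x * b * S y)) p = \<epsilon> a * t b)"


section \<open>Lie algebras and their modules\<close>

locale lie_algebra = vector_space sL
  for sL :: "'f::field \<Rightarrow> 'l::ab_group_add \<Rightarrow> 'l" +
  fixes br :: "'l \<Rightarrow> 'l \<Rightarrow> 'l"
  assumes bracket_linear_left: "Vector_Spaces.linear sL sL (\<lambda>a. br a b)"
    and bracket_linear_right: "Vector_Spaces.linear sL sL (\<lambda>b. br a b)"
    and bracket_alternating: "br a a = 0"
    and jacobi: "br a (br b c) + br b (br c a) + br c (br a b) = 0"

locale lie_representation = lie_algebra sL br + V: vector_space sV
  for sL :: "'f::field \<Rightarrow> 'l::ab_group_add \<Rightarrow> 'l" and br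
    and sV :: "'f \<Rightarrow> 'v::ab_group_add \<Rightarrow> 'v" +
  fixes \<psi> :: "'l \<Rightarrow> 'v \<Rightarrow> 'v"
  assumes action_linear: "Vector_Spaces.linear sV sV (\<psi> a)"
    and action_add: "\<psi> (a + b) v = \<psi> a v + \<psi> b v"
    and action_scale: "\<psi> (sL c a) v = sV c (\<psi> a v)"
    and action_bracket: "\<psi> (br a b) v = \<psi> a (\<psi> b v) - \<psi> b (\<psi> a v)"

locale comodule_lie_algebra =
  hopf_algebra sH \<Delta> \<epsilon> S + L: lie_algebra sL br + L: comodule sH \<Delta> \<epsilon> sL \<rho>L
  for sH :: "'f::field \<Rightarrow> 'h::ring_1 \<Rightarrow> 'h" and \<Delta> \<epsilon> S
    and sL :: "'f \<Rightarrow> 'l::ab_group_add \<Rightarrow> 'l" and br \<rho>L +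
  assumes coaction_bracket: "\<lbrakk>p \<in> \<rho>L a; q \<in> \<rho>L b\<rbrakk> \<Longrightarrow>
    lin_ext fscale (\<lambda>(a0, a1). lin_ext fscale (\<lambda>(b0, b1).
      Poly_Mapping.single (br a0 b0, a1 * b1) 1) q) p \<in> \<rho>L (br a b)"

locale hl_module =
  comodule_lie_algebra sH \<Delta> \<epsilon> S sL br \<rho>L + V: lie_representation sL br sV \<psi> + V: comodule sH \<Delta> \<epsilon> sV \<rho>V
  for sH :: "'f::field \<Rightarrow> 'h::ring_1 \<Rightarrow> 'h" and \<Delta> \<epsilon> S
    and sL :: "'f \<Rightarrow> 'l::ab_group_add \<Rightarrow> 'l" and br \<rho>L
    and sV :: "'f \<Rightarrow> 'v::ab_group_add \<Rightarrow> 'v" and \<rho>V \<psi> +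
  assumes coaction_action: "\<lbrakk>p \<in> \<rho>L a; q \<in> \<rho>V v\<rbrakk> \<Longrightarrow>
    lin_ext fscale (\<lambda>(a0, a1). lin_ext fscale (\<lambda>(v0, v1).
      Poly_Mapping.single (\<psi> a0 v0, a1 * v1) 1) q) p \<in> \<rho>V (\<psi> a v)"


section \<open>Submodules, irreducibility, direct sums\<close>

definition lie_submodule ::
    "('f::field \<Rightarrow> 'v::ab_group_add \<Rightarrow> 'v) \<Rightarrow> ('l \<Rightarrow> 'v \<Rightarrow> 'v) \<Rightarrow> 'v set \<Rightarrow> bool" where
  "lie_submodule sV \<psi> W \<longleftrightarrow> module.subspace sV W \<and> (\<forall>a. \<forall>w\<in>W. \<psi> a w \<in> W)"

text \<open>
  \<open>\<rho>(W) \<subseteq> W \<otimes> H\<close> inside \<open>V \<otimes> H\<close>: every \<open>\<rho>(w)\<close> has an expression with all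
  first tensor factors in \<open>W\<close>.
\<close>

definition subcomodule ::
    "('f::field \<Rightarrow> 'v::ab_group_add \<Rightarrow> 'v) \<Rightarrow> ('v \<Rightarrow> ('v \<times> 'h \<Rightarrow>\<^sub>0 'f) set) \<Rightarrow> 'v set \<Rightarrow> bool" where
  "subcomodule sV \<rho> W \<longleftrightarrow> module.subspace sV W \<and>
     (\<forall>w\<in>W. \<exists>p\<in>\<rho> w. Poly_Mapping.keys p \<subseteq> W \<times> UNIV)"

definition hl_submodule ::
    "('f::field \<Rightarrow> 'v::ab_group_add \<Rightarrow> 'v) \<Rightarrow> ('v \<Rightarrow> ('v \<times> 'h \<Rightarrow>\<^sub>0 'f) set) \<Rightarrow>
     ('l \<Rightarrow> 'v \<Rightarrow> 'v) \<Rightarrow> 'v set \<Rightarrow> bool" where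
  "hl_submodule sV \<rho> \<psi> W \<longleftrightarrow> lie_submodule sV \<psi> W \<and> subcomodule sV \<rho> W"

text \<open>Irreducible modules are required to be nonzero.\<close>

definition irreducible_lie_submodule ::
    "('f::field \<Rightarrow> 'v::ab_group_add \<Rightarrow> 'v) \<Rightarrow> ('l \<Rightarrow> 'v \<Rightarrow> 'v) \<Rightarrow> 'v set \<Rightarrow> bool" where
  "irreducible_lie_submodule sV \<psi> W \<longleftrightarrow> lie_submodule sV \<psi> W \<and> W \<noteq> {0} \<and>
     (\<forall>U. lie_submodule sV \<psi> U \<and> U \<subseteq> W \<longrightarrow> U = {0} \<or> U = W)"

definition irreducible_hl_submodule ::
    "('f::field \<Rightarrow> 'v::ab_group_add \<Rightarrow> 'v) \<Rightarrow> ('v \<Rightarrow> ('v \<times> 'h \<Rightarrow>\<^sub>0 'f) set) \<Rightarrow>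
     ('l \<Rightarrow> 'v \<Rightarrow> 'v) \<Rightarrow> 'v set \<Rightarrow> bool" where
  "irreducible_hl_submodule sV \<rho> \<psi> W \<longleftrightarrow> hl_submodule sV \<rho> \<psi> W \<and> W \<noteq> {0} \<and>
     (\<forall>U. hl_submodule sV \<rho> \<psi> U \<and> U \<subseteq> W \<longrightarrow> U = {0} \<or> U = W)"

text \<open>The whole space is the internal direct sum of the family \<open>W\<close> of subspaces.\<close>

definition is_direct_sum ::
    "('f::field \<Rightarrow> 'v::ab_group_add \<Rightarrow> 'v) \<Rightarrow> 'i set \<Rightarrow> ('i \<Rightarrow> 'v set) \<Rightarrow> bool" where
  "is_direct_sum sV I W \<longleftrightarrow>
     (\<forall>i\<in>I. module.subspace sV (W i)) \<and>
     module.span sV (\<Union>i\<in>I. W i) = UNIV \<and>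
     (\<forall>i\<in>I. W i \<inter> module.span sV (\<Union>j\<in>I - {i}. W j) = {0})"

text \<open>
  A completely reducible module is a direct sum of irreducible submodules. Distinct members of such
  a family are different subspaces, so the family may be indexed by a set of subspaces.
\<close>

definition completely_reducible ::
    "('f::field \<Rightarrow> 'v::ab_group_add \<Rightarrow> 'v) \<Rightarrow> ('l \<Rightarrow> 'v \<Rightarrow> 'v) \<Rightarrow> bool" where
  "completely_reducible sV \<psi> \<longleftrightarrow>
     (\<exists>\<W>. is_direct_sum sV \<W> (\<lambda>W. W) \<and> (\<forall>W\<in>\<W>. irreducible_lie_submodule sV \<psi> W))"

end

theory Submission
  imports Defs "HOL-Library.Set_Algebras"
begin

text \<open>
  This is Maschke's theorem with the integral \<open>t\<close> in the place of the average over a group. It is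
  enough that every \<open>(H, L)\<close>-submodule \<open>W\<close> has a complement that is an \<open>(H, L)\<close>-submodule: then a
  minimal nonzero submodule can be split off, and induction on the dimension decomposes \<open>V\<close>
  (\<open>hl_submodule_decomposition\<close>).

  Complete reducibility over \<open>L\<close> gives a projection \<open>\<pi>\<close> of \<open>V\<close> onto \<open>W\<close> that commutes with \<open>L\<close> but perhaps
  not with the coaction. In Sweedler notation the average of \<open>\<pi>\<close> is
  \[ \bar\pi(v) = t\bigl(\pi(v_{(0)})_{(1)}\, S(v_{(1)})\bigr)\, \pi(v_{(0)})_{(0)}, \]
  that is, \<open>t\<close> applied to the second factor of
  \[ \Phi(v) = \pi(v_{(0)})_{(0)} \otimes \pi(v_{(0)})_{(1)} S(v_{(1)}) \in V \otimes H. \]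
  It takes values in \<open>W\<close> because \<open>W\<close> is a subcomodule, and \<open>t(1) = 1\<close> makes it the identity on \<open>W\<close>. That \<open>t\<close>
  is ad-invariant makes it commute with \<open>L\<close> (\<open>avg_action\<close>), and that \<open>t\<close> is a left integral makes it
  a comodule map (\<open>avg_coef\<close>). So its kernel is the complement that is needed.

  Both computations are usually done with the rules for \<open>S(a b)\<close> and \<open>\<Delta>(S(a))\<close>. These are avoided here: \<open>\<Phi>\<close>
  satisfies, and by the antipode axiom is determined by,
  \[ \Phi(v_{(0)})\, v_{(1)} = \rho(\pi(v)) \]
  (\<open>twisted_coef\<close> and \<open>cancel_coaction\<close>), and this equation can be compared directly with the
  multiplicativity of \<open>\<rho>\<close> and of \<open>\<Delta>\<close>.

  Tensors are handled in coordinates. A basis of a comodule turns \<open>\<rho>\<close> into a matrix of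
  coefficients in \<open>H\<close> with \<open>\<Delta>(c\<^sub>e\<^sub>v) = \<Sum>\<^sub>f c\<^sub>e\<^sub>f \<otimes> c\<^sub>f\<^sub>v\<close> (\<open>comult_coef\<close>), so that \<open>S\<close> applied entrywise gives the inverse
  matrix. After that, all identities are between finite sums in \<open>H\<close>. A basis of \<open>L\<close>, even an
  infinite one, serves as well, since each column of the matrix is finite.
\<close>

section \<open>Calculating with tensor expressions\<close>


lemma lin_ext_sum_single:
  assumes "vector_space s"
  shows "lin_ext s g (\<Sum>i\<in>I. Poly_Mapping.single (k i) 1) = (\<Sum>i\<in>I. g (k i))"
proof -
  interpret l: Vector_Spaces.linear fscale s "lin_ext s g" by (rule linear_lin_ext[OF assms])
  show ?thesis by (simp add: l.sum assms)
qed

lemma linear_comp_lin_ext: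
  assumes "Vector_Spaces.linear s s' f"
  shows "f (lin_ext s g p) = lin_ext s' (\<lambda>k. f (g k)) p"
proof -
  interpret l: Vector_Spaces.linear s s' f by fact
  show ?thesis by (simp add: lin_ext_def l.sum l.scale)
qed

lemma lin_ext_cong:
  assumes "\<And>k. k \<in> Poly_Mapping.keys p \<Longrightarrow> g k = h k"
  shows "lin_ext s g p = lin_ext s h p"
  using assms by (simp add: lin_ext_def)

lemma lin_ext_single_id: "lin_ext fscale (\<lambda>k. Poly_Mapping.single k 1) p = p"
  by (rule poly_mapping_eqI)
    (simp add: lin_ext_def lookup_sum lookup_single when_def sum.If_cases in_keys_iff if_distrib sum.delta cong: if_cong)

context
  fixes sA :: "'f::field \<Rightarrow> 'a::ab_group_add \<Rightarrow> 'a" and sB :: "'f \<Rightarrow> 'b::ab_group_add \<Rightarrow> 'b"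
begin

lemma subspace_tensor_null: "free.subspace (tensor_null sA sB)"
  by (simp add: tensor_null_def)

lemma tensor_null_add_left:
  "Poly_Mapping.single (x + x', y) 1 - Poly_Mapping.single (x, y) 1 - Poly_Mapping.single (x', y) 1
    \<in> tensor_null sA sB"
  unfolding tensor_null_def by (rule free.span_base) blast

lemma tensor_null_add_right:
  "Poly_Mapping.single (x, y + y') 1 - Poly_Mapping.single (x, y) 1 - Poly_Mapping.single (x, y') 1
    \<in> tensor_null sA sB"
  unfolding tensor_null_def by (rule free.span_base) blast

lemma tensor_null_scale_left:
  "Poly_Mapping.single (sA c x, y) 1 - fscale c (Poly_Mapping.single (x, y) 1) \<in> tensor_null sA sB"
  unfolding tensor_null_def by (rule free.span_base) blast

lemma tensor_null_scale_right:
  "Poly_Mapping.single (x, sB c y) 1 - fscale c (Poly_Mapping.single (x, y) 1) \<in> tensor_null sA sB"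
  unfolding tensor_null_def by (rule free.span_base) blast

text \<open>Two expressions are related when they denote the same element of the tensor product.\<close>

definition tensor_eq (infix "\<approx>" 50) where
  "p \<approx> q \<longleftrightarrow> p - q \<in> tensor_null sA sB"

lemma tensor_eq_refl: "p \<approx> p"
  using free.subspace_0[OF subspace_tensor_null] by (simp add: tensor_eq_def)

lemma tensor_eq_sym: "p \<approx> q \<Longrightarrow> q \<approx> p"
  using free.subspace_neg[OF subspace_tensor_null] by (fastforce simp: tensor_eq_def)

lemma tensor_eq_trans [trans]: "p \<approx> q \<Longrightarrow> q \<approx> r \<Longrightarrow> p \<approx> r"
  using free.subspace_add[OF subspace_tensor_null] by (fastforce simp: tensor_eq_def)

lemma tensor_eq_add: "p \<approx> q \<Longrightarrow> p' \<approx> q' \<Longrightarrow> p + p' \<approx> q + q'"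
  using free.subspace_add[OF subspace_tensor_null, of "p - q" "p' - q'"]
  by (simp add: tensor_eq_def algebra_simps)

lemma tensor_eq_fscale: "p \<approx> q \<Longrightarrow> fscale c p \<approx> fscale c q"
  using free.subspace_scale[OF subspace_tensor_null, of "p - q" c]
  by (simp add: tensor_eq_def free.scale_right_diff_distrib)

lemma tensor_eq_sum: "(\<And>i. i \<in> I \<Longrightarrow> p i \<approx> q i) \<Longrightarrow> (\<Sum>i\<in>I. p i) \<approx> (\<Sum>i\<in>I. q i)"
  by (induction I rule: infinite_finite_induct) (auto simp: tensor_eq_refl intro: tensor_eq_add)

lemma tensor_eq_lin_ext:
  "(\<And>k. k \<in> Poly_Mapping.keys p \<Longrightarrow> g k \<approx> h k) \<Longrightarrow> lin_ext fscale g p \<approx> lin_ext fscale h p"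
  unfolding lin_ext_def by (intro tensor_eq_sum tensor_eq_fscale)

lemma tensor_eq_single_zero_right: "Poly_Mapping.single (x, 0) 1 \<approx> 0"
  using free.subspace_neg[OF subspace_tensor_null, OF tensor_null_add_right[of x 0 0]]
  by (simp add: tensor_eq_def)

lemma tensor_eq_single_zero_left: "Poly_Mapping.single (0, y) 1 \<approx> 0"
  using free.subspace_neg[OF subspace_tensor_null, OF tensor_null_add_left[of 0 0 y]]
  by (simp add: tensor_eq_def)

lemma tensor_eq_single_add_right:
  "Poly_Mapping.single (x, y + y') 1 \<approx> Poly_Mapping.single (x, y) 1 + Poly_Mapping.single (x, y') 1"
  using tensor_null_add_right[of x y y'] by (simp add: tensor_eq_def algebra_simps)

lemma tensor_eq_single_add_left:
  "Poly_Mapping.single (x + x', y) 1 \<approx> Poly_Mapping.single (x, y) 1 + Poly_Mapping.single (x', y) 1"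
  using tensor_null_add_left[of x x' y] by (simp add: tensor_eq_def algebra_simps)

lemma tensor_eq_single_sum_right:
  "Poly_Mapping.single (x, \<Sum>i\<in>I. y i) 1 \<approx> (\<Sum>i\<in>I. Poly_Mapping.single (x, y i) 1)"
proof (induction I rule: infinite_finite_induct)
  case (insert i I)
  have "Poly_Mapping.single (x, y i + (\<Sum>i\<in>I. y i)) 1
      \<approx> Poly_Mapping.single (x, y i) 1 + Poly_Mapping.single (x, \<Sum>i\<in>I. y i) 1"
    by (rule tensor_eq_single_add_right)
  also have "\<dots> \<approx> Poly_Mapping.single (x, y i) 1 + (\<Sum>i\<in>I. Poly_Mapping.single (x, y i) 1)"
    by (intro tensor_eq_add tensor_eq_refl insert)
  finally show ?case using insert by simp
qed (auto simp: tensor_eq_single_zero_right)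

lemma tensor_eq_single_sum_left:
  "Poly_Mapping.single (\<Sum>i\<in>I. x i, y) 1 \<approx> (\<Sum>i\<in>I. Poly_Mapping.single (x i, y) 1)"
proof (induction I rule: infinite_finite_induct)
  case (insert i I)
  have "Poly_Mapping.single (x i + (\<Sum>i\<in>I. x i), y) 1
      \<approx> Poly_Mapping.single (x i, y) 1 + Poly_Mapping.single (\<Sum>i\<in>I. x i, y) 1"
    by (rule tensor_eq_single_add_left)
  also have "\<dots> \<approx> Poly_Mapping.single (x i, y) 1 + (\<Sum>i\<in>I. Poly_Mapping.single (x i, y) 1)"
    by (intro tensor_eq_add tensor_eq_refl insert)
  finally show ?case using insert by simp
qed (auto simp: tensor_eq_single_zero_left)

lemma tensor_eq_fscale_single_right:
  "fscale c (Poly_Mapping.single (x, y) 1) \<approx> Poly_Mapping.single (x, sB c y) 1"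
  by (rule tensor_eq_sym) (use tensor_null_scale_right in \<open>simp add: tensor_eq_def\<close>)

lemma tensor_eq_fscale_single_left:
  "fscale c (Poly_Mapping.single (x, y) 1) \<approx> Poly_Mapping.single (sA c x, y) 1"
  by (rule tensor_eq_sym) (use tensor_null_scale_left in \<open>simp add: tensor_eq_def\<close>)

lemma tensor_space_mem_iff:
  assumes "X \<in> tensor_space sA sB" "p \<in> X"
  shows "q \<in> X \<longleftrightarrow> q \<approx> p"
proof -
  obtain r where X: "X = coset_of (tensor_null sA sB) r" using assms by (auto simp: tensor_space_def)
  have "p \<approx> r" using assms X by (simp add: coset_of_def tensor_eq_def)
  moreover have "q \<in> X \<longleftrightarrow> q \<approx> r" using X by (simp add: coset_of_def tensor_eq_def)
  ultimately show ?thesis using tensor_eq_trans tensor_eq_sym by blast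
qed

lemma tensor_space_nonempty: "X \<in> tensor_space sA sB \<Longrightarrow> \<exists>p. p \<in> X"
proof -
  assume "X \<in> tensor_space sA sB"
  then obtain r where "X = coset_of (tensor_null sA sB) r" by (auto simp: tensor_space_def)
  then have "r \<in> X" using free.subspace_0[OF subspace_tensor_null] by (simp add: coset_of_def)
  then show ?thesis ..
qed

end

text \<open>
  Expanding all first factors in \<open>F\<close> and collecting terms brings a tensor into the form
  \<open>\<Sum>\<^sub>e e \<otimes> h\<^sub>e\<close>. Only the coefficients \<open>h\<^sub>e\<close> matter from here on.
\<close>

lemma tensor_eq_basis_expansion:
  assumes "vector_space sA" "vector_space sB" "finite F"
    and exp: "\<And>x y. (x, y) \<in> Poly_Mapping.keys p \<Longrightarrow> x = (\<Sum>e\<in>F. sA (c e x) e)"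
  shows "tensor_eq sA sB p (\<Sum>e\<in>F. Poly_Mapping.single (e, lin_ext sB (\<lambda>(x, y). sB (c e x) y) p) 1)"
proof -
  interpret B: vector_space sB by fact
  note [trans] = tensor_eq_trans[of sA sB]
  let ?l = "Poly_Mapping.lookup p" and ?K = "Poly_Mapping.keys p"
  have 1: "tensor_eq sA sB (fscale (?l k) (Poly_Mapping.single k 1))
      (\<Sum>e\<in>F. Poly_Mapping.single (e, sB (?l k) (sB (c e (fst k)) (snd k))) 1)" if "k \<in> ?K" for k
  proof -
    obtain x y where k: "k = (x, y)" by force
    have "x = (\<Sum>e\<in>F. sA (c e x) e)" using that k by (intro exp[of x y]) simp
    then have "tensor_eq sA sB (Poly_Mapping.single (x, y) 1) (\<Sum>e\<in>F. Poly_Mapping.single (sA (c e x) e, y) 1)"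
      using tensor_eq_single_sum_left[of sA sB "\<lambda>e. sA (c e x) e" F y] by simp
    also have "tensor_eq sA sB \<dots> (\<Sum>e\<in>F. fscale (c e x) (Poly_Mapping.single (e, y) 1))"
      by (intro tensor_eq_sum tensor_eq_sym[OF tensor_eq_fscale_single_left])
    also have "tensor_eq sA sB \<dots> (\<Sum>e\<in>F. (Poly_Mapping.single (e, sB (c e x) y) 1))"
      by (intro tensor_eq_sum tensor_eq_fscale_single_right)
    finally have "tensor_eq sA sB (fscale (?l k) (Poly_Mapping.single (x, y) 1))
       (fscale (?l k) (\<Sum>e\<in>F. (Poly_Mapping.single (e, sB (c e x) y) 1)))" by (rule tensor_eq_fscale)
    also have "\<dots> = (\<Sum>e\<in>F. fscale (?l k) (Poly_Mapping.single (e, sB (c e x) y) 1))"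
      by (rule free.scale_sum_right)
    also have "tensor_eq sA sB \<dots> (\<Sum>e\<in>F. (Poly_Mapping.single (e, sB (?l k) (sB (c e x) y)) 1))"
      by (intro tensor_eq_sum tensor_eq_fscale_single_right)
    finally show ?thesis by (simp add: k)
  qed
  have "p = (\<Sum>k\<in>?K. fscale (?l k) (Poly_Mapping.single k 1))"
    using lin_ext_single_id[of p] by (simp add: lin_ext_def)
  then have "tensor_eq sA sB p (\<Sum>k\<in>?K. fscale (?l k) (Poly_Mapping.single k 1))"
    using tensor_eq_refl[of sA sB p] by simp
  also have "tensor_eq sA sB \<dots> (\<Sum>k\<in>?K. \<Sum>e\<in>F. Poly_Mapping.single (e, sB (?l k) (sB (c e (fst k)) (snd k))) 1)"
    by (intro tensor_eq_sum 1)
  also have "\<dots> = (\<Sum>e\<in>F. \<Sum>k\<in>?K. Poly_Mapping.single (e, sB (?l k) (sB (c e (fst k)) (snd k))) 1)"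
    by (rule sum.swap)
  also have "tensor_eq sA sB \<dots> (\<Sum>e\<in>F. Poly_Mapping.single (e, \<Sum>k\<in>?K. sB (?l k) (sB (c e (fst k)) (snd k))) 1)"
    by (intro tensor_eq_sum tensor_eq_sym[OF tensor_eq_single_sum_right])
  finally show ?thesis by (simp add: lin_ext_def case_prod_unfold)
qed

section \<open>The coefficient matrix of a comodule\<close>

locale based_comodule = comodule sH \<Delta> \<epsilon> sV \<rho>
  for sH :: "'f::field \<Rightarrow> 'h::ab_group_add \<Rightarrow> 'h" and \<Delta> \<epsilon>
    and sV :: "'f \<Rightarrow> 'v::ab_group_add \<Rightarrow> 'v" and \<rho> +
  fixes B :: "'v set"
  assumes independent_B: "V.independent B"
    and span_B: "V.span B = UNIV"
begin

definition coord :: "'v \<Rightarrow> 'v \<Rightarrow> 'f" where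
  "coord e v = V.representation B v e"

lemma coord_add: "coord e (u + v) = coord e u + coord e v"
  unfolding coord_def by (subst V.representation_add[OF independent_B]) (auto simp: span_B)

lemma coord_scale: "coord e (sV c v) = c * coord e v"
  unfolding coord_def by (subst V.representation_scale[OF independent_B]) (auto simp: span_B)

lemma coord_basis: "f \<in> B \<Longrightarrow> coord e f = (if e = f then 1 else 0)"
  unfolding coord_def by (subst V.representation_basis[OF independent_B]) auto

lemma coord_outside: "e \<notin> B \<Longrightarrow> coord e v = 0"
  unfolding coord_def using V.representation_ne_zero by blast

lemma finite_coord_support: "finite {e. coord e v \<noteq> 0}"
  unfolding coord_def by (rule V.finite_representation)

lemma coord_linear: "Vector_Spaces.linear sV (*) (coord e)"
  unfolding Vector_Spaces.linear_iff
  using V.vector_space_axioms by (auto simp: coord_add coord_scale vector_space_def algebra_simps)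

lemma coord_expansion:
  assumes "finite F" "{e. coord e v \<noteq> 0} \<subseteq> F"
  shows "v = (\<Sum>e\<in>F. sV (coord e v) e)"
proof -
  have "v = (\<Sum>e | coord e v \<noteq> 0. sV (coord e v) e)"
    using V.sum_nonzero_representation_eq[OF independent_B] unfolding coord_def by (simp add: span_B)
  also have "\<dots> = (\<Sum>e\<in>F. sV (coord e v) e)"
    by (rule sum.mono_neutral_left) (use assms in auto)
  finally show ?thesis .
qed

lemma linear_coord_expansion:
  assumes "Vector_Spaces.linear sV s g" "finite F" "{e. coord e v \<noteq> 0} \<subseteq> F"
  shows "g v = (\<Sum>e\<in>F. s (coord e v) (g e))"
proof -
  interpret l: Vector_Spaces.linear sV s g by fact
  show ?thesis by (subst coord_expansion[OF assms(2,3)]) (simp add: l.sum l.scale)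
qed

lemma coaction_tensor_space: "\<rho> v \<in> tensor_space sV sH"
  using coaction_linear by (simp add: tensor_linear_def)

lemma comult_tensor_space: "\<Delta> a \<in> tensor_space sH sH"
  using comult_linear by (simp add: tensor_linear_def)

lemma coaction_add: "p \<in> \<rho> u \<Longrightarrow> q \<in> \<rho> v \<Longrightarrow> p + q \<in> \<rho> (u + v)"
  using coaction_linear by (simp add: tensor_linear_def)

lemma coaction_scale: "p \<in> \<rho> u \<Longrightarrow> fscale c p \<in> \<rho> (sV c u)"
  using coaction_linear by (simp add: tensor_linear_def)

text \<open>
  The entries of the coefficient matrix: \<open>\<rho>(v) = \<Sum>\<^sub>e e \<otimes> coef e v\<close> over the basis, so that \<open>coef e v\<close> is the dual
  basis functional of \<open>e\<close> applied to the first factor of \<open>\<rho>(v)\<close>.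
\<close>

definition coef :: "'v \<Rightarrow> 'v \<Rightarrow> 'h" where
  "coef e v = lin_ext sH (\<lambda>(u, x). sH (coord e u) x) (SOME p. p \<in> \<rho> v)"

lemma bilinear_lin_ext_coaction:
  assumes "\<And>y. Vector_Spaces.linear sV s (\<lambda>x. g (x, y))"
    and "\<And>x. Vector_Spaces.linear sH s (\<lambda>y. g (x, y))"
    and "p \<in> \<rho> v" "q \<in> \<rho> v"
  shows "lin_ext s g p = lin_ext s g q"
  using lin_ext_tensor_well_defined[OF assms(1,2) coaction_tensor_space assms(3,4)] .

lemma coef_eq:
  assumes "p \<in> \<rho> v"
  shows "coef e v = lin_ext sH (\<lambda>(u, x). sH (coord e u) x) p"
  unfolding coef_def
  by (rule bilinear_lin_ext_coaction[OF _ _ _ assms])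
    (auto simp: Vector_Spaces.linear_iff V.vector_space_axioms vector_space_axioms coord_add coord_scale
      scale_left_distrib scale_right_distrib assms mult.commute intro: someI[of "\<lambda>p. p \<in> \<rho> v", OF assms])

lemma coaction_nonempty: obtains p where "p \<in> \<rho> v"
  using tensor_space_nonempty[OF coaction_tensor_space] by blast

lemma coef_add: "coef e (u + v) = coef e u + coef e v"
proof -
  interpret l: Vector_Spaces.linear fscale sH "lin_ext sH (\<lambda>(u, x). sH (coord e u) x)"
    by (rule linear_lin_ext) (rule vector_space_axioms)
  obtain p q where "p \<in> \<rho> u" "q \<in> \<rho> v" using coaction_nonempty by metis
  then show ?thesis using coaction_add[of p u q v] by (simp add: coef_eq l.add)
qed

lemma coef_scale: "coef e (sV c v) = sH c (coef e v)"
proof -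
  interpret l: Vector_Spaces.linear fscale sH "lin_ext sH (\<lambda>(u, x). sH (coord e u) x)"
    by (rule linear_lin_ext) (rule vector_space_axioms)
  obtain p where "p \<in> \<rho> v" using coaction_nonempty by metis
  then show ?thesis using coaction_scale[of p v c] by (simp add: coef_eq l.scale)
qed

lemma coef_linear: "Vector_Spaces.linear sV sH (coef e)"
  by (simp add: Vector_Spaces.linear_iff V.vector_space_axioms vector_space_axioms coef_add coef_scale)

lemma coef_outside: "e \<notin> B \<Longrightarrow> coef e v = 0"
  by (simp add: coef_def lin_ext_def coord_outside case_prod_unfold)

definition coef_support :: "'v \<Rightarrow> 'v set" where
  "coef_support v = {e. coef e v \<noteq> 0}"

text \<open>
  One expression of \<open>\<rho>(v)\<close> has finitely many terms, and finitely many basis vectors occur in them; both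
  claims come from its normal form. The index set \<open>F\<close> is left free so that several vectors can share
  one; the additional terms are \<open>e \<otimes> 0\<close>, which are zero in the tensor product but not as expressions.
\<close>

lemma
  shows finite_coef_support: "finite (coef_support v)"
    and coaction_coef: "\<lbrakk>finite F; coef_support v \<subseteq> F\<rbrakk> \<Longrightarrow> (\<Sum>e\<in>F. Poly_Mapping.single (e, coef e v) 1) \<in> \<rho> v"
proof -
  obtain p where p: "p \<in> \<rho> v" using coaction_nonempty .
  define G where "G = (\<Union>k\<in>Poly_Mapping.keys p. {e. coord e (fst k) \<noteq> 0})"
  have G: "finite G" by (simp add: G_def finite_coord_support)
  have "coef e v = 0" if "e \<notin> G" for e
    using that by (auto simp: coef_eq[OF p] G_def lin_ext_def case_prod_unfold intro!: sum.neutral)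
  then have sub: "coef_support v \<subseteq> G" by (auto simp: coef_support_def)
  then show "finite (coef_support v)" using G finite_subset by blast
  have "tensor_eq sV sH p (\<Sum>e\<in>G. Poly_Mapping.single (e, lin_ext sH (\<lambda>(x, y). sH (coord e x) y) p) 1)"
    by (rule tensor_eq_basis_expansion[OF V.vector_space_axioms vector_space_axioms G], rule coord_expansion[OF G])
      (force simp: G_def)
  then have G_eq: "tensor_eq sV sH p (\<Sum>e\<in>G. Poly_Mapping.single (e, coef e v) 1)"
    by (simp only: coef_eq[OF p])
  assume F: "finite F" "coef_support v \<subseteq> F"
  note [trans] = tensor_eq_trans[of sV sH]
  have reduce: "tensor_eq sV sH (\<Sum>e\<in>F. Poly_Mapping.single (e, coef e v) 1)
      (\<Sum>e\<in>coef_support v. Poly_Mapping.single (e, coef e v) 1)" if F: "finite F" "coef_support v \<subseteq> F" for F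
  proof -
    have "tensor_eq sV sH (\<Sum>e\<in>F. Poly_Mapping.single (e, coef e v) 1)
      (\<Sum>e\<in>F. if e \<in> coef_support v then Poly_Mapping.single (e, coef e v) 1 else 0)"
      by (intro tensor_eq_sum) (auto simp: tensor_eq_refl coef_support_def tensor_eq_single_zero_right)
    also have "\<dots> = (\<Sum>e\<in>coef_support v. Poly_Mapping.single (e, coef e v) 1)"
      using F by (simp add: sum.If_cases Int_absorb1 Int_absorb2)
    finally show ?thesis .
  qed
  note reduce[OF F]
  also have "tensor_eq sV sH (\<Sum>e\<in>coef_support v. Poly_Mapping.single (e, coef e v) 1)
      (\<Sum>e\<in>G. Poly_Mapping.single (e, coef e v) 1)"
    by (rule tensor_eq_sym[OF reduce[OF G sub]])
  also have "tensor_eq sV sH \<dots> p" by (rule tensor_eq_sym[OF G_eq])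
  finally show "(\<Sum>e\<in>F. Poly_Mapping.single (e, coef e v) 1) \<in> \<rho> v"
    using tensor_space_mem_iff[OF coaction_tensor_space p] by blast
qed

lemma counit_coef: "\<epsilon> (coef e v) = coord e v"
proof -
  let ?F = "coef_support v"
  interpret \<epsilon>: Vector_Spaces.linear sH "(*)" \<epsilon> by (rule counit_linear)
  interpret c: Vector_Spaces.linear sV "(*)" "coord e" by (rule coord_linear)
  have "v = lin_ext sV (\<lambda>(u, x). sV (\<epsilon> x) u) (\<Sum>e\<in>?F. Poly_Mapping.single (e, coef e v) 1)"
    using coaction_counit[OF coaction_coef] finite_coef_support by simp
  also have "\<dots> = (\<Sum>f\<in>?F. sV (\<epsilon> (coef f v)) f)"
    by (simp add: lin_ext_sum_single V.vector_space_axioms)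
  finally have "coord e v = coord e (\<Sum>f\<in>?F. sV (\<epsilon> (coef f v)) f)" by simp
  also have "\<dots> = (\<Sum>f\<in>?F. \<epsilon> (coef f v) * coord e f)" by (simp add: c.sum c.scale)
  also have "\<dots> = (\<Sum>f\<in>?F. if e = f then \<epsilon> (coef e v) else 0)"
  proof (rule sum.cong[OF refl])
    fix f assume "f \<in> ?F"
    then have "f \<in> B" using coef_outside by (auto simp: coef_support_def)
    then show "\<epsilon> (coef f v) * coord e f = (if e = f then \<epsilon> (coef e v) else 0)" by (simp add: coord_basis)
  qed
  also have "\<dots> = \<epsilon> (coef e v)"
    using finite_coef_support by (auto simp: coef_support_def \<epsilon>.zero)
  finally show ?thesis by simp
qed

text \<open>
  Contracting the first of three factors with a basis coordinate is well defined on the tensor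
  product. This transports coassociativity, an equation in \<open>V \<otimes> H \<otimes> H\<close>, to \<open>H \<otimes> H\<close>.
\<close>

lemma coord_tensor3:
  assumes "p \<in> tensor_null3 sV sH sH"
  shows "lin_ext fscale (\<lambda>(u, k). fscale (coord e u) (Poly_Mapping.single k 1)) p \<in> tensor_null sH sH"
    (is "?E p \<in> _")
  using assms unfolding tensor_null3_def
proof (induction rule: free.span_induct)
  interpret l: Vector_Spaces.linear fscale fscale ?E by (rule linear_lin_ext) (rule free.vector_space_axioms)
  case base
  show ?case
    using subspace_tensor_null[of sH sH] by (auto simp: free.subspace_def l.add l.scale)
next
  interpret l: Vector_Spaces.linear fscale fscale ?E by (rule linear_lin_ext) (rule free.vector_space_axioms)
  note [simp] = lin_ext_single[OF free.vector_space_axioms]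
  note sub = subspace_tensor_null[of sH sH]
  have z: "0 \<in> tensor_null sH sH" by (rule free.subspace_0[OF sub])
  have sc1: "fscale (c * coord e u) w = fscale c (fscale (coord e u) w)" for c u w
    by simp
  have sc2: "fscale c (fscale (coord e u) w) = fscale (coord e u) (fscale c w)" for c u w
    by (simp add: mult.commute)
  case (step r)
  then show ?case
    by (auto simp: l.diff l.scale coord_add coord_scale free.scale_left_distrib z sc1 sc2
          simp del: free.scale_scale simp flip: free.scale_right_diff_distrib
          intro!: free.subspace_scale[OF sub] tensor_null_add_left tensor_null_add_right
            tensor_null_scale_left tensor_null_scale_right)
qed

text \<open>
  The comultiplication is matrix multiplication on coefficients. Contract the first factor in
  \<open>(\<rho> \<otimes> id) \<circ> \<rho> = (id \<otimes> \<Delta>) \<circ> \<rho>\<close> with the coordinate of \<open>e\<close>.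
\<close>

lemma comult_coef:
  assumes "finite F" "coef_support v \<subseteq> F" "F \<subseteq> B"
  shows "(\<Sum>f\<in>F. Poly_Mapping.single (coef e f, coef f v) 1) \<in> \<Delta> (coef e v)"
proof -
  let ?E = "lin_ext fscale (\<lambda>(u, k). fscale (coord e u) (Poly_Mapping.single k 1))"
  interpret l: Vector_Spaces.linear fscale fscale ?E by (rule linear_lin_ext) (rule free.vector_space_axioms)
  note [simp] = lin_ext_single[OF free.vector_space_axioms] lin_ext_sum_single[OF free.vector_space_axioms]
  define d where "d a = (SOME p. p \<in> \<Delta> a)" for a
  have d: "d a \<in> \<Delta> a" for a
    unfolding d_def using tensor_space_nonempty[OF comult_tensor_space] by (rule someI_ex)
  define r where "r u = (\<Sum>e\<in>coef_support u. Poly_Mapping.single (e, coef e u) (1::'f))" for u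
  have r: "r u \<in> \<rho> u" for u unfolding r_def by (rule coaction_coef) (auto simp: finite_coef_support)
  note [trans] = tensor_eq_trans[of sH sH]
  let ?p = "\<Sum>f\<in>F. Poly_Mapping.single (f, coef f v) 1"
  have "coset_of (tensor_null3 sV sH sH)
        (lin_ext fscale (\<lambda>(u, x). lin_ext fscale (\<lambda>(u0, u1). Poly_Mapping.single (u0, u1, x) 1) (r u)) ?p) =
      coset_of (tensor_null3 sV sH sH)
        (lin_ext fscale (\<lambda>(u, x). lin_ext fscale (\<lambda>(x1, x2). Poly_Mapping.single (u, x1, x2) 1) (d x)) ?p)"
    (is "coset_of ?N ?L = coset_of ?N ?R")
    by (rule coaction_coassoc[OF r d coaction_coef[OF assms(1,2)]])
  moreover have "?L \<in> coset_of ?N ?L"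
    by (simp add: coset_of_def tensor_null3_def free.span_zero)
  ultimately have "?L - ?R \<in> ?N" by (auto simp: coset_of_def)
  from coord_tensor3[OF this, of e] have eq: "tensor_eq sH sH (?E ?L) (?E ?R)"
    by (simp only: l.diff tensor_eq_def)
  have left: "?E ?L = (\<Sum>f\<in>F. \<Sum>g\<in>coef_support f. fscale (coord e g) (Poly_Mapping.single (coef g f, coef f v) 1))"
  proof -
    have "?L = (\<Sum>f\<in>F. \<Sum>g\<in>coef_support f. Poly_Mapping.single (g, coef g f, coef f v) 1)"
      by (simp add: r_def)
    then show ?thesis by (simp only: l.sum) simp
  qed
  have delta: "tensor_eq sH sH (\<Sum>g\<in>coef_support f. fscale (coord e g) (Poly_Mapping.single (coef g f, y) 1))
      (Poly_Mapping.single (coef e f, y) 1)" for f y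
  proof -
    have "(\<Sum>g\<in>coef_support f. fscale (coord e g) (Poly_Mapping.single (coef g f, y) 1))
        = (\<Sum>g\<in>coef_support f. if g = e then Poly_Mapping.single (coef e f, y) 1 else 0)"
    proof (rule sum.cong[OF refl])
      fix g assume "g \<in> coef_support f"
      then have "g \<in> B" using coef_outside by (auto simp: coef_support_def)
      then show "fscale (coord e g) (Poly_Mapping.single (coef g f, y) 1) =
          (if g = e then Poly_Mapping.single (coef e f, y) 1 else 0)"
        by (simp add: coord_basis)
    qed
    also have "\<dots> = (if e \<in> coef_support f then Poly_Mapping.single (coef e f, y) 1 else 0)"
      by (simp add: finite_coef_support)
    finally show ?thesis
      by (simp add: coef_support_def tensor_eq_refl tensor_eq_sym[OF tensor_eq_single_zero_left])
  qed
  have L: "tensor_eq sH sH (?E ?L) (\<Sum>f\<in>F. Poly_Mapping.single (coef e f, coef f v) 1)"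
    unfolding left by (intro tensor_eq_sum delta)
  have inner: "?E (lin_ext fscale (\<lambda>(x1, x2). Poly_Mapping.single (f, x1, x2) 1) q) = fscale (coord e f) q" for f q
  proof -
    have "?E (lin_ext fscale (\<lambda>(x1, x2). Poly_Mapping.single (f, x1, x2) 1) q)
      = lin_ext fscale (\<lambda>k. fscale (coord e f) (Poly_Mapping.single k 1)) q"
      by (subst linear_comp_lin_ext[OF l.linear_axioms]) (simp add: case_prod_unfold)
    also have "\<dots> = fscale (coord e f) (lin_ext fscale (\<lambda>k. Poly_Mapping.single k 1) q)"
      by (rule linear_comp_lin_ext[symmetric, OF free.linear_scale_self])
    finally show ?thesis by (simp add: lin_ext_single_id)
  qed
  have "?E ?R = (\<Sum>f\<in>F. fscale (coord e f) (d (coef f v)))"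
    by (simp add: l.sum inner)
  also have "\<dots> = (\<Sum>f\<in>F. if f = e then d (coef e v) else 0)"
    by (rule sum.cong) (use assms in \<open>auto simp: coord_basis subset_iff\<close>)
  also have "\<dots> = (if e \<in> F then d (coef e v) else 0)" using assms by simp
  finally have R: "?E ?R = (if e \<in> F then d (coef e v) else 0)" .
  have "?E ?R \<in> \<Delta> (coef e v)"
  proof (cases "e \<in> F")
    case True
    then show ?thesis using R d by simp
  next
    case False
    have "fscale 0 (d 0) \<in> \<Delta> (sH 0 0)"
      using comult_linear d[of 0] by (simp only: tensor_linear_def)
    moreover have "coef e v = 0" using False assms by (auto simp: coef_support_def)
    ultimately show ?thesis using False R by simp
  qed
  moreover have "tensor_eq sH sH (\<Sum>f\<in>F. Poly_Mapping.single (coef e f, coef f v) 1) (?E ?R)"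
    by (rule tensor_eq_trans[OF tensor_eq_sym[OF L] eq])
  ultimately show ?thesis by (rule tensor_space_mem_iff[OF comult_tensor_space, THEN iffD2])
qed

end

text \<open>
  Over a Hopf algebra, the entrywise antipode inverts the coefficient matrix on both sides.
\<close>

locale based_hopf_comodule = hopf_algebra sH \<Delta> \<epsilon> S + based_comodule sH \<Delta> \<epsilon> sV \<rho> B
  for sH :: "'f::field \<Rightarrow> 'h::ring_1 \<Rightarrow> 'h" and \<Delta> \<epsilon> S
    and sV :: "'f \<Rightarrow> 'v::ab_group_add \<Rightarrow> 'v" and \<rho> B
begin

lemma coef_support_subset: "coef_support v \<subseteq> B"
  using coef_outside by (auto simp: coef_support_def)

lemma coord_support_subset: "{e. coord e v \<noteq> 0} \<subseteq> coef_support v"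
proof -
  interpret \<epsilon>: Vector_Spaces.linear sH "(*)" \<epsilon> by (rule counit_linear)
  show ?thesis by (auto simp: coef_support_def \<epsilon>.zero simp flip: counit_coef)
qed

lemma antipode_coef_left:
  assumes "finite F" "coef_support v \<subseteq> F" "F \<subseteq> B"
  shows "(\<Sum>f\<in>F. S (coef e f) * coef f v) = sH (coord e v) 1"
  using antipode_left[OF comult_coef[OF assms]]
  by (simp add: lin_ext_sum_single vector_space_axioms counit_coef)

lemma antipode_coef_right:
  assumes "finite F" "coef_support v \<subseteq> F" "F \<subseteq> B"
  shows "(\<Sum>f\<in>F. coef e f * S (coef f v)) = sH (coord e v) 1"
  using antipode_right[OF comult_coef[OF assms]]
  by (simp add: lin_ext_sum_single vector_space_axioms counit_coef)

end

locale finite_hopf_comodule = based_hopf_comodule +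
  assumes finite_B: "finite B"
begin

lemma coord_expansion_B: "v = (\<Sum>e\<in>B. sV (coord e v) e)"
  using coord_expansion[OF finite_B] coord_outside by blast

lemma linear_coord_expansion_B:
  assumes "Vector_Spaces.linear sV s g"
  shows "g v = (\<Sum>e\<in>B. s (coord e v) (g e))"
  using linear_coord_expansion[OF assms finite_B] coord_outside by blast

lemma coord_eqI: "(\<And>e. e \<in> B \<Longrightarrow> coord e u = coord e v) \<Longrightarrow> u = v"
  by (subst coord_expansion_B, subst (2) coord_expansion_B) simp

lemma coord_sum_B:
  assumes "e \<in> B"
  shows "coord e (\<Sum>f\<in>B. sV (c f) f) = c e"
proof -
  interpret l: Vector_Spaces.linear sV "(*)" "coord e" by (rule coord_linear)
  have "coord e (\<Sum>f\<in>B. sV (c f) f) = (\<Sum>f\<in>B. c f * coord e f)" by (simp add: l.sum l.scale)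
  also have "\<dots> = (\<Sum>f\<in>B. if e = f then c e else 0)"
    by (rule sum.cong) (auto simp: coord_basis)
  finally show ?thesis using assms finite_B by simp
qed

lemmas coaction_coef_B = coaction_coef[OF finite_B coef_support_subset]
lemmas comult_coef_B = comult_coef[OF finite_B coef_support_subset order_refl]
lemmas antipode_coef_left_B = antipode_coef_left[OF finite_B coef_support_subset order_refl]
lemmas antipode_coef_right_B = antipode_coef_right[OF finite_B coef_support_subset order_refl]

text \<open>
  The map \<open>X(v) \<mapsto> X(v\<^sub>(\<^sub>0\<^sub>)) v\<^sub>(\<^sub>1\<^sub>)\<close> on linear \<open>X\<close> is injective: \<open>X(v\<^sub>(\<^sub>0\<^sub>)) v\<^sub>(\<^sub>1\<^sub>) S(v\<^sub>(\<^sub>2\<^sub>)) = X(v)\<close>. This replaces the rule for \<open>S(a b)\<close>.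
\<close>

lemma cancel_coaction:
  assumes X: "Vector_Spaces.linear sV sH X" and Y: "Vector_Spaces.linear sV sH Y"
    and eq: "\<And>v. (\<Sum>g\<in>B. X g * coef g v) = (\<Sum>g\<in>B. Y g * coef g v)"
  shows "X v = Y v"
proof -
  have expand: "X v = (\<Sum>f\<in>B. (\<Sum>g\<in>B. X g * coef g f) * S (coef f v))"
    if X: "Vector_Spaces.linear sV sH X" for X
  proof -
    have "X v = (\<Sum>g\<in>B. X g * sH (coord g v) 1)"
      by (subst linear_coord_expansion_B[OF X]) (simp add: mult_scale_right)
    also have "\<dots> = (\<Sum>g\<in>B. \<Sum>f\<in>B. X g * coef g f * S (coef f v))"
      by (simp add: antipode_coef_right_B[symmetric] sum_distrib_left mult.assoc)
    also have "\<dots> = (\<Sum>f\<in>B. \<Sum>g\<in>B. X g * coef g f * S (coef f v))" by (rule sum.swap)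
    finally show ?thesis by (simp add: sum_distrib_right)
  qed
  show ?thesis by (simp add: expand[OF X] expand[OF Y] eq)
qed

end

section \<open>Averaging a projection with the integral\<close>

locale integral_averaging =
  hl_module sH \<Delta> \<epsilon> S sL br \<rho>L sV \<rho>V \<psi> + V: finite_hopf_comodule sH \<Delta> \<epsilon> S sV \<rho>V B +
  L: based_hopf_comodule sH \<Delta> \<epsilon> S sL \<rho>L K
  for sH :: "'f::field \<Rightarrow> 'h::ring_1 \<Rightarrow> 'h" and \<Delta> \<epsilon> S
    and sL :: "'f \<Rightarrow> 'l::ab_group_add \<Rightarrow> 'l" and br \<rho>L
    and sV :: "'f \<Rightarrow> 'v::ab_group_add \<Rightarrow> 'v" and \<rho>V \<psi> B K +
  fixes t :: "'h \<Rightarrow> 'f" and W :: "'v set" and \<pi> :: "'v \<Rightarrow> 'v"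
  assumes integral: "left_integral sH \<Delta> t"
    and ad_inv: "ad_invariant \<Delta> \<epsilon> S t"
    and integral_one: "t 1 = 1"
    and W_submodule: "hl_submodule sV \<rho>V \<psi> W"
    and \<pi>_linear: "Vector_Spaces.linear sV sV \<pi>"
    and \<pi>_in_W: "\<pi> v \<in> W"
    and \<pi>_on_W: "w \<in> W \<Longrightarrow> \<pi> w = w"
    and \<pi>_action: "\<pi> (\<psi> a v) = \<psi> a (\<pi> v)"
begin

lemma integral_linear: "Vector_Spaces.linear sH (*) t"
  using integral by (simp add: left_integral_def)

sublocale t: Vector_Spaces.linear sH "(*)" t
  by (rule integral_linear)

sublocale S: Vector_Spaces.linear sH sH S
  by (rule antipode_linear)

sublocale p: Vector_Spaces.linear sV sV \<pi>
  by (rule \<pi>_linear)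

lemmas linear_iffs = Vector_Spaces.linear_iff V.V.vector_space_axioms vector_space_axioms
  L.vector_space_axioms t.vs2.vector_space_axioms

text \<open>
  The coefficient at \<open>e\<close> of \<open>\<Phi>(v) = \<pi>(v\<^sub>(\<^sub>0\<^sub>))\<^sub>(\<^sub>0\<^sub>) \<otimes> \<pi>(v\<^sub>(\<^sub>0\<^sub>))\<^sub>(\<^sub>1\<^sub>) S(v\<^sub>(\<^sub>1\<^sub>))\<close>.
\<close>

definition twisted :: "'v \<Rightarrow> 'v \<Rightarrow> 'h" where
  "twisted e v = (\<Sum>f\<in>B. V.coef e (\<pi> f) * S (V.coef f v))"

definition avg :: "'v \<Rightarrow> 'v" where
  "avg v = (\<Sum>e\<in>B. sV (t (twisted e v)) e)"

lemma twisted_linear: "Vector_Spaces.linear sV sH (twisted e)"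
  by (simp add: linear_iffs twisted_def V.coef_add V.coef_scale S.add S.scale
      distrib_left mult_scale_right sum.distrib scale_sum_right)

sublocale twisted: Vector_Spaces.linear sV sH "twisted e" for e
  by (rule twisted_linear)

lemma avg_linear: "Vector_Spaces.linear sV sV avg"
  by (simp add: linear_iffs avg_def twisted.add twisted.scale t.add t.scale
      V.V.scale_left_distrib sum.distrib V.V.scale_sum_right)

sublocale avg: Vector_Spaces.linear sV sV avg
  by (rule avg_linear)

lemma coord_avg: "e \<in> B \<Longrightarrow> V.coord e (avg v) = t (twisted e v)"
  unfolding avg_def by (rule V.coord_sum_B)

text \<open>\<open>\<Phi>(v\<^sub>(\<^sub>0\<^sub>)) v\<^sub>(\<^sub>1\<^sub>) = \<rho>(\<pi>(v))\<close>, because \<open>S(v\<^sub>(\<^sub>1\<^sub>)) v\<^sub>(\<^sub>2\<^sub>)\<close> cancels.\<close>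

lemma twisted_coef: "(\<Sum>f\<in>B. twisted e f * V.coef f v) = V.coef e (\<pi> v)"
proof -
  have lin: "Vector_Spaces.linear sV sH (\<lambda>v. V.coef e (\<pi> v))"
    by (simp add: linear_iffs p.add p.scale V.coef_add V.coef_scale)
  have "(\<Sum>f\<in>B. twisted e f * V.coef f v)
      = (\<Sum>f\<in>B. \<Sum>g\<in>B. V.coef e (\<pi> g) * (S (V.coef g f) * V.coef f v))"
    by (simp add: twisted_def sum_distrib_right mult.assoc)
  also have "\<dots> = (\<Sum>g\<in>B. \<Sum>f\<in>B. V.coef e (\<pi> g) * (S (V.coef g f) * V.coef f v))"
    by (rule sum.swap)
  also have "\<dots> = (\<Sum>g\<in>B. V.coef e (\<pi> g) * sH (V.coord g v) 1)"
    by (simp add: sum_distrib_left[symmetric] V.antipode_coef_left_B)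
  also have "\<dots> = V.coef e (\<pi> v)"
    by (subst V.linear_coord_expansion_B[OF lin, of v]) (simp add: mult_scale_right)
  finally show ?thesis .
qed

lemma coef_action:
  assumes "finite M" "L.coef_support a \<subseteq> M"
  shows "V.coef e (\<psi> a v) = (\<Sum>l\<in>M. \<Sum>f\<in>B. sH (V.coord e (\<psi> l f)) (L.coef l a * V.coef f v))"
proof -
  interpret l: Vector_Spaces.linear fscale sH "lin_ext sH g" for g :: "'v \<times> 'h \<Rightarrow> 'h"
    by (rule linear_lin_ext) (rule vector_space_axioms)
  show ?thesis
    unfolding V.coef_eq[OF coaction_action[OF L.coaction_coef[OF assms] V.coaction_coef_B]]
    by (simp add: lin_ext_sum_single free.vector_space_axioms vector_space_axioms l.sum)
qed

text \<open>
  In Sweedler notation, \<open>\<Phi>(a\<^sub>(\<^sub>0\<^sub>) v) a\<^sub>(\<^sub>1\<^sub>) = a\<^sub>(\<^sub>0\<^sub>) \<Phi>(v)\<^sub>(\<^sub>0\<^sub>) \<otimes> a\<^sub>(\<^sub>1\<^sub>) \<Phi>(v)\<^sub>(\<^sub>1\<^sub>)\<close>. By \<open>cancel_coaction\<close> it may be checked after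
  replacing \<open>v\<close> by \<open>v\<^sub>(\<^sub>0\<^sub>)\<close> and multiplying by \<open>v\<^sub>(\<^sub>1\<^sub>)\<close> on the right; then the left side is \<open>\<rho>(\<pi>(a v))\<close> and the right side is
  \<open>\<rho>(a \<pi>(v))\<close>.
\<close>

lemma twisted_action:
  assumes M: "finite M" "L.coef_support a \<subseteq> M"
  shows "(\<Sum>l\<in>M. twisted e (\<psi> l v) * L.coef l a)
    = (\<Sum>l\<in>M. \<Sum>f\<in>B. sH (V.coord e (\<psi> l f)) (L.coef l a * twisted f v))"
proof (rule V.cancel_coaction)
  have act: "\<psi> l (u + v) = \<psi> l u + \<psi> l v" "\<psi> l (sV c v) = sV c (\<psi> l v)" for l u v c
    using V.action_linear by (auto simp: Vector_Spaces.linear_iff)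
  show "Vector_Spaces.linear sV sH (\<lambda>v. \<Sum>l\<in>M. twisted e (\<psi> l v) * L.coef l a)"
    by (simp add: linear_iffs twisted.add twisted.scale act distrib_right mult_scale_left sum.distrib scale_sum_right)
  show "Vector_Spaces.linear sV sH (\<lambda>v. \<Sum>l\<in>M. \<Sum>f\<in>B. sH (V.coord e (\<psi> l f)) (L.coef l a * twisted f v))"
    by (simp add: linear_iffs twisted.add twisted.scale act distrib_left mult_scale_right sum.distrib scale_sum_right
         scale_right_distrib mult.commute)
next
  fix v
  have "(\<Sum>g\<in>B. (\<Sum>l\<in>M. twisted e (\<psi> l g) * L.coef l a) * V.coef g v)
      = (\<Sum>l\<in>M. \<Sum>g\<in>B. twisted e (\<psi> l g) * (L.coef l a * V.coef g v))"
    by (simp add: sum_distrib_right mult.assoc) (rule sum.swap)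
  also have "\<dots> = (\<Sum>l\<in>M. \<Sum>g\<in>B. \<Sum>h\<in>B. twisted e h * sH (V.coord h (\<psi> l g)) (L.coef l a * V.coef g v))"
    by (subst V.linear_coord_expansion_B[OF twisted_linear])
      (simp add: sum_distrib_right mult_scale_left mult_scale_right)
  also have "\<dots> = (\<Sum>l\<in>M. \<Sum>h\<in>B. \<Sum>g\<in>B. twisted e h * sH (V.coord h (\<psi> l g)) (L.coef l a * V.coef g v))"
    by (rule sum.cong[OF refl], rule sum.swap)
  also have "\<dots> = (\<Sum>h\<in>B. \<Sum>l\<in>M. \<Sum>g\<in>B. twisted e h * sH (V.coord h (\<psi> l g)) (L.coef l a * V.coef g v))"
    by (rule sum.swap)
  also have "\<dots> = (\<Sum>h\<in>B. twisted e h * V.coef h (\<psi> a v))"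
    by (simp add: coef_action[OF M] sum_distrib_left)
  also have "\<dots> = V.coef e (\<psi> a (\<pi> v))" by (simp add: twisted_coef \<pi>_action)
  also have "\<dots> = (\<Sum>l\<in>M. \<Sum>f\<in>B. \<Sum>g\<in>B. sH (V.coord e (\<psi> l f)) (L.coef l a * (twisted f g * V.coef g v)))"
    by (simp add: coef_action[OF M] sum_distrib_left scale_sum_right flip: twisted_coef)
  also have "\<dots> = (\<Sum>l\<in>M. \<Sum>g\<in>B. \<Sum>f\<in>B. sH (V.coord e (\<psi> l f)) (L.coef l a * (twisted f g * V.coef g v)))"
    by (rule sum.cong[OF refl], rule sum.swap)
  also have "\<dots> = (\<Sum>g\<in>B. \<Sum>l\<in>M. \<Sum>f\<in>B. sH (V.coord e (\<psi> l f)) (L.coef l a * (twisted f g * V.coef g v)))"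
    by (rule sum.swap)
  also have "\<dots> = (\<Sum>g\<in>B. (\<Sum>l\<in>M. \<Sum>f\<in>B. sH (V.coord e (\<psi> l f)) (L.coef l a * twisted f g)) * V.coef g v)"
    by (simp add: sum_distrib_right mult_scale_left mult.assoc)
  finally show "(\<Sum>g\<in>B. (\<Sum>l\<in>M. twisted e (\<psi> l g) * L.coef l a) * V.coef g v)
    = (\<Sum>g\<in>B. (\<Sum>l\<in>M. \<Sum>f\<in>B. sH (V.coord e (\<psi> l f)) (L.coef l a * twisted f g)) * V.coef g v)" .
qed

text \<open>
  Multiplying \<open>twisted_action\<close> by \<open>S(a\<^sub>(\<^sub>2\<^sub>))\<close> gives \<open>\<Phi>(a v) = a\<^sub>(\<^sub>0\<^sub>) \<Phi>(v)\<^sub>(\<^sub>0\<^sub>) \<otimes> a\<^sub>(\<^sub>1\<^sub>) \<Phi>(v)\<^sub>(\<^sub>1\<^sub>) S(a\<^sub>(\<^sub>2\<^sub>))\<close>, to which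
  ad-invariance of \<open>t\<close> applies.
\<close>

lemma avg_action: "avg (\<psi> a v) = \<psi> a (avg v)"
proof (rule V.coord_eqI)
  fix e assume e: "e \<in> B"
  \<comment> \<open>\<open>A\<close> carries the column of \<open>a\<close>, and \<open>M\<close> also the columns of all members of \<open>A\<close>, as needed for
    the second application of the coaction.\<close>
  define A where "A = L.coef_support a"
  define M where "M = A \<union> (\<Union>k\<in>A. L.coef_support k)"
  have A: "finite A" "A \<subseteq> K" "L.coef_support a \<subseteq> A"
    by (auto simp: A_def L.finite_coef_support dest: L.coef_support_subset[THEN subsetD])
  have M: "finite M" "M \<subseteq> K" "L.coef_support a \<subseteq> M" "\<And>k. k \<in> A \<Longrightarrow> L.coef_support k \<subseteq> M"
    using A by (auto simp: M_def L.finite_coef_support dest: L.coef_support_subset[THEN subsetD])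
  have coord_M: "{l. L.coord l a \<noteq> 0} \<subseteq> M"
    using L.coord_support_subset M(3) by blast
  have lin1: "Vector_Spaces.linear sL sH (\<lambda>a. twisted e (\<psi> a v))"
    by (simp add: linear_iffs V.action_add V.action_scale twisted.add twisted.scale)
  have lin2: "Vector_Spaces.linear sL (*) (\<lambda>a. V.coord e (\<psi> a f))" for f
    by (simp add: linear_iffs V.action_add V.action_scale V.coord_add V.coord_scale)
  interpret act: Vector_Spaces.linear sV sV "\<psi> a" by (rule V.action_linear)
  interpret ce: Vector_Spaces.linear sV "(*)" "V.coord e" by (rule V.coord_linear)
  have ad: "(\<Sum>k\<in>A. t (L.coef l k * b * S (L.coef k a))) = L.coord l a * t b" for l b
  proof -
    have "lin_ext (*) (\<lambda>(x, y). t (x * b * S y)) (\<Sum>k\<in>A. Poly_Mapping.single (L.coef l k, L.coef k a) 1)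
        = \<epsilon> (L.coef l a) * t b"
      using ad_inv L.comult_coef[OF A(1,3,2)] unfolding ad_invariant_def by blast
    then show ?thesis
      by (simp add: lin_ext_sum_single t.vs2.vector_space_axioms L.counit_coef)
  qed
  have "twisted e (\<psi> a v) = (\<Sum>l\<in>M. twisted e (\<psi> l v) * sH (L.coord l a) 1)"
    by (subst L.linear_coord_expansion[OF lin1 M(1) coord_M]) (simp add: mult_scale_right)
  also have "\<dots> = (\<Sum>l\<in>M. \<Sum>k\<in>A. twisted e (\<psi> l v) * L.coef l k * S (L.coef k a))"
    by (simp add: L.antipode_coef_right[OF A(1,3,2), symmetric] sum_distrib_left mult.assoc)
  also have "\<dots> = (\<Sum>k\<in>A. (\<Sum>l\<in>M. twisted e (\<psi> l v) * L.coef l k) * S (L.coef k a))"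
    by (subst sum.swap) (simp add: sum_distrib_right)
  also have "\<dots> = (\<Sum>k\<in>A. (\<Sum>l\<in>M. \<Sum>f\<in>B. sH (V.coord e (\<psi> l f)) (L.coef l k * twisted f v)) * S (L.coef k a))"
    by (simp add: twisted_action[OF M(1,4)])
  also have "\<dots> = (\<Sum>k\<in>A. \<Sum>l\<in>M. \<Sum>f\<in>B. sH (V.coord e (\<psi> l f)) (L.coef l k * twisted f v * S (L.coef k a)))"
    by (simp add: sum_distrib_right mult_scale_left)
  also have "\<dots> = (\<Sum>l\<in>M. \<Sum>f\<in>B. \<Sum>k\<in>A. sH (V.coord e (\<psi> l f)) (L.coef l k * twisted f v * S (L.coef k a)))"
    by (subst sum.swap) (rule sum.cong[OF refl], rule sum.swap)
  finally have "t (twisted e (\<psi> a v))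
      = (\<Sum>l\<in>M. \<Sum>f\<in>B. V.coord e (\<psi> l f) * (\<Sum>k\<in>A. t (L.coef l k * twisted f v * S (L.coef k a))))"
    by (simp add: t.sum t.scale sum_distrib_left)
  also have "\<dots> = (\<Sum>l\<in>M. \<Sum>f\<in>B. V.coord e (\<psi> l f) * (L.coord l a * t (twisted f v)))"
    by (simp only: ad)
  also have "\<dots> = (\<Sum>f\<in>B. \<Sum>l\<in>M. V.coord e (\<psi> l f) * (L.coord l a * t (twisted f v)))"
    by (rule sum.swap)
  also have "\<dots> = (\<Sum>f\<in>B. t (twisted f v) * V.coord e (\<psi> a f))"
  proof (rule sum.cong[OF refl])
    fix f
    have "V.coord e (\<psi> a f) = (\<Sum>l\<in>M. L.coord l a * V.coord e (\<psi> l f))"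
      by (rule L.linear_coord_expansion[OF lin2 M(1) coord_M])
    then show "(\<Sum>l\<in>M. V.coord e (\<psi> l f) * (L.coord l a * t (twisted f v)))
        = t (twisted f v) * V.coord e (\<psi> a f)"
      by (simp only: sum_distrib_left mult.commute mult.left_commute)
  qed
  also have "\<dots> = V.coord e (\<psi> a (avg v))"
    by (simp add: avg_def act.sum act.scale ce.sum ce.scale)
  finally show "V.coord e (avg (\<psi> a v)) = V.coord e (\<psi> a (avg v))" by (simp add: coord_avg e)
qed

text \<open>
  The linear map \<open>x \<otimes> y \<mapsto> t(y z) x\<close> from \<open>H \<otimes> H\<close> to \<open>H\<close>, evaluated at \<open>\<Delta>(a)\<close>. The left integral property says
  that its value for \<open>z = 1\<close> is \<open>t(a) 1\<close>; the factor \<open>z\<close> makes room for an antipode.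
\<close>

definition slice :: "'h \<Rightarrow> 'h \<Rightarrow> 'h" where
  "slice z a = lin_ext sH (\<lambda>(x, y). sH (t (y * z)) x) (SOME p. p \<in> \<Delta> a)"

lemma slice_eq:
  assumes "p \<in> \<Delta> a"
  shows "slice z a = lin_ext sH (\<lambda>(x, y). sH (t (y * z)) x) p"
  unfolding slice_def
  by (rule lin_ext_tensor_well_defined[OF _ _ V.comult_tensor_space _ assms])
    (auto simp: linear_iffs t.add t.scale scale_left_distrib scale_right_distrib distrib_right mult_scale_left
      mult.commute intro: someI[of "\<lambda>p. p \<in> \<Delta> a", OF assms])

lemma comult_nonempty: obtains p where "p \<in> \<Delta> a"
  using tensor_space_nonempty[OF V.comult_tensor_space] by blast

lemma slice_add: "slice z (a + b) = slice z a + slice z b"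
proof -
  interpret l: Vector_Spaces.linear fscale sH "lin_ext sH (\<lambda>(x, y). sH (t (y * z)) x)"
    by (rule linear_lin_ext) (rule vector_space_axioms)
  obtain p q where "p \<in> \<Delta> a" "q \<in> \<Delta> b" using comult_nonempty by metis
  moreover have "p + q \<in> \<Delta> (a + b)" using calculation comult_linear by (simp add: tensor_linear_def)
  ultimately show ?thesis by (simp add: slice_eq l.add)
qed

lemma slice_zero: "slice z 0 = 0"
  using slice_add[of z 0 0] by simp

lemma slice_sum: "slice z (\<Sum>i\<in>I. g i) = (\<Sum>i\<in>I. slice z (g i))"
  by (induction I rule: infinite_finite_induct) (auto simp: slice_zero slice_add)

lemma slice_coef: "slice z (V.coef e v) = (\<Sum>f\<in>B. sH (t (V.coef f v * z)) (V.coef e f))"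
  by (subst slice_eq[OF V.comult_coef_B]) (simp add: lin_ext_sum_single vector_space_axioms)

lemma slice_one: "slice 1 a = sH (t a) 1"
proof -
  obtain p where p: "p \<in> \<Delta> a" using comult_nonempty .
  then show ?thesis using integral by (simp add: slice_eq[OF p] left_integral_def)
qed

lemma slice_mult_coef:
  "slice z (a * V.coef e v) = (\<Sum>f\<in>B. slice (V.coef f v * z) a * V.coef e f)"
proof -
  interpret l: Vector_Spaces.linear fscale sH "lin_ext sH g" for g :: "'h \<times> 'h \<Rightarrow> 'h"
    by (rule linear_lin_ext) (rule vector_space_axioms)
  obtain p where p: "p \<in> \<Delta> a" using comult_nonempty .
  have rmul: "Vector_Spaces.linear sH sH (\<lambda>x. x * y)" for y
    by (simp add: linear_iffs distrib_right mult_scale_left)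
  have "slice z (a * V.coef e v) = lin_ext sH (\<lambda>(x, y). \<Sum>f\<in>B. sH (t (y * V.coef f v * z)) (x * V.coef e f)) p"
    unfolding slice_eq[OF comult_mult[OF p V.comult_coef_B]]
    by (subst linear_comp_lin_ext[OF l.linear_axioms])
      (simp add: lin_ext_sum_single free.vector_space_axioms vector_space_axioms l.sum case_prod_unfold)
  also have "\<dots> = (\<Sum>f\<in>B. lin_ext sH (\<lambda>(x, y). sH (t (y * V.coef f v * z)) (x * V.coef e f)) p)"
    by (simp add: lin_ext_def case_prod_unfold scale_sum_right) (rule sum.swap)
  also have "\<dots> = (\<Sum>f\<in>B. slice (V.coef f v * z) a * V.coef e f)"
    by (simp add: slice_eq[OF p] linear_comp_lin_ext[OF rmul] case_prod_unfold mult_scale_left mult.assoc)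
  finally show ?thesis .
qed

lemma slice_scale: "slice (sH c z) a = sH c (slice z a)"
  by (simp add: slice_def lin_ext_def case_prod_unfold mult_scale_right t.scale scale_sum_right
      mult.commute mult.left_commute)

lemma slice_add_left: "slice (z + z') a = slice z a + slice z' a"
  by (simp add: slice_def lin_ext_def case_prod_unfold distrib_left t.add scale_right_distrib scale_left_distrib sum.distrib)

lemma slice_sum_left: "slice (\<Sum>i\<in>I. g i) a = (\<Sum>i\<in>I. slice (g i) a)"
proof -
  have "slice 0 a = 0" using slice_add_left[of 0 0 a] by simp
  then show ?thesis by (induction I rule: infinite_finite_induct) (auto simp: slice_add_left)
qed

text \<open>
  In Sweedler notation, \<open>\<rho>(\<pi>'(u)) = \<pi>'(u\<^sub>(\<^sub>0\<^sub>)) \<otimes> u\<^sub>(\<^sub>1\<^sub>)\<close> for the average \<open>\<pi>'\<close> of \<open>\<pi>\<close>. Apply \<open>\<Delta>\<close> to both sides of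
  \<open>twisted_coef\<close>, cancel the last coefficient by an antipode, and apply \<open>t\<close>; \<open>slice\<close> performs the three
  steps together. The integral property enters through \<open>slice_one\<close>.
\<close>

lemma avg_coef: "V.coef e (avg u) = (\<Sum>f\<in>B. sH (t (twisted e f)) (V.coef f u))"
proof -
  interpret coef: Vector_Spaces.linear sV sH "V.coef e" by (rule V.coef_linear)
  have "V.coef e (avg u) = (\<Sum>g\<in>B. sH (t (twisted g u)) (V.coef e g))"
    by (simp add: avg_def coef.sum coef.scale)
  also have "\<dots> = (\<Sum>g\<in>B. \<Sum>b\<in>B. sH (t (V.coef g (\<pi> b) * S (V.coef b u))) (V.coef e g))"
    by (simp add: twisted_def t.sum scale_sum_left)
  also have "\<dots> = (\<Sum>b\<in>B. slice (S (V.coef b u)) (V.coef e (\<pi> b)))"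
    by (subst sum.swap) (simp add: slice_coef)
  also have "\<dots> = (\<Sum>b\<in>B. \<Sum>f\<in>B. \<Sum>h\<in>B. slice (V.coef h b * S (V.coef b u)) (twisted e f) * V.coef f h)"
    by (simp add: slice_sum slice_mult_coef flip: twisted_coef)
  also have "\<dots> = (\<Sum>f\<in>B. \<Sum>b\<in>B. \<Sum>h\<in>B. slice (V.coef h b * S (V.coef b u)) (twisted e f) * V.coef f h)"
    by (rule sum.swap)
  also have "\<dots> = (\<Sum>f\<in>B. \<Sum>h\<in>B. \<Sum>b\<in>B. slice (V.coef h b * S (V.coef b u)) (twisted e f) * V.coef f h)"
    by (rule sum.cong[OF refl], rule sum.swap)
  also have "\<dots> = (\<Sum>f\<in>B. \<Sum>h\<in>B. slice (sH (V.coord h u) 1) (twisted e f) * V.coef f h)"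
    by (simp add: slice_sum_left sum_distrib_right flip: V.antipode_coef_right_B)
  also have "\<dots> = (\<Sum>f\<in>B. \<Sum>h\<in>B. sH (t (twisted e f)) (sH (V.coord h u) (V.coef f h)))"
    by (simp add: slice_scale slice_one mult_scale_left mult.commute)
  also have "\<dots> = (\<Sum>f\<in>B. sH (t (twisted e f)) (V.coef f u))"
    unfolding V.linear_coord_expansion_B[OF V.coef_linear, of _ u] by (simp only: scale_sum_right)
  finally show ?thesis .
qed

lemma W_subspace: "V.V.subspace W"
  using W_submodule by (simp add: hl_submodule_def lie_submodule_def)

lemma W_coaction:
  assumes "w \<in> W" obtains p where "p \<in> \<rho>V w" "Poly_Mapping.keys p \<subseteq> W \<times> UNIV"
  using W_submodule assms unfolding hl_submodule_def subcomodule_def by blast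

text \<open>
  The value at \<open>w \<in> W\<close> of \<open>v \<mapsto> t(v\<^sub>(\<^sub>1\<^sub>) h) v\<^sub>(\<^sub>0\<^sub>)\<close> does not depend on the expression of \<open>\<rho>(w)\<close>, so one with first factors in
  \<open>W\<close> can be used in the place of the expansion in the basis, whose vectors need not lie in \<open>W\<close>.
\<close>

lemma avg_in_W: "avg v \<in> W"
proof -
  have *: "(\<Sum>e\<in>B. sV (t (V.coef e w * h)) e) \<in> W" if "w \<in> W" for w h
  proof -
    obtain p where p: "p \<in> \<rho>V w" "Poly_Mapping.keys p \<subseteq> W \<times> UNIV" using W_coaction[OF \<open>w \<in> W\<close>] .
    have "(\<Sum>e\<in>B. sV (t (V.coef e w * h)) e)
        = lin_ext sV (\<lambda>(u, x). sV (t (x * h)) u) (\<Sum>e\<in>B. Poly_Mapping.single (e, V.coef e w) 1)"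
      by (simp add: lin_ext_sum_single V.V.vector_space_axioms)
    also have "\<dots> = lin_ext sV (\<lambda>(u, x). sV (t (x * h)) u) p"
      by (rule V.bilinear_lin_ext_coaction[OF _ _ V.coaction_coef_B p(1)])
        (simp_all add: linear_iffs V.V.scale_right_distrib V.V.scale_left_distrib distrib_right mult_scale_left
          t.add t.scale mult.commute)
    also have "\<dots> \<in> W"
      unfolding lin_ext_def
      by (rule V.V.subspace_sum[OF W_subspace], rule V.V.subspace_scale[OF W_subspace])
        (use p(2) in \<open>auto intro: V.V.subspace_scale[OF W_subspace]\<close>)
    finally show ?thesis .
  qed
  have "avg v = (\<Sum>e\<in>B. \<Sum>f\<in>B. sV (t (V.coef e (\<pi> f) * S (V.coef f v))) e)"
    by (simp add: avg_def twisted_def t.sum V.V.scale_sum_left)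
  also have "\<dots> = (\<Sum>f\<in>B. \<Sum>e\<in>B. sV (t (V.coef e (\<pi> f) * S (V.coef f v))) e)"
    by (rule sum.swap)
  also have "\<dots> \<in> W"
    by (intro V.V.subspace_sum[OF W_subspace] * \<pi>_in_W)
  finally show ?thesis .
qed

text \<open>
  With an expression of \<open>\<rho>(w)\<close> whose first factors lie in \<open>W\<close>, the map \<open>\<pi>\<close> drops out of \<open>\<Phi>(w)\<close>, and
  \<open>w\<^sub>(\<^sub>0\<^sub>) \<otimes> w\<^sub>(\<^sub>1\<^sub>) S(w\<^sub>(\<^sub>2\<^sub>)) = w \<otimes> 1\<close> remains.
\<close>

lemma avg_on_W:
  assumes "w \<in> W"
  shows "avg w = w"
proof (rule V.coord_eqI)
  fix e assume e: "e \<in> B"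
  obtain p where p: "p \<in> \<rho>V w" "Poly_Mapping.keys p \<subseteq> W \<times> UNIV" using W_coaction[OF assms] .
  have "twisted e w = lin_ext sH (\<lambda>(u, x). V.coef e (\<pi> u) * S x) (\<Sum>f\<in>B. Poly_Mapping.single (f, V.coef f w) 1)"
    by (simp add: twisted_def lin_ext_sum_single vector_space_axioms)
  also have "\<dots> = lin_ext sH (\<lambda>(u, x). V.coef e (\<pi> u) * S x) p"
    by (rule V.bilinear_lin_ext_coaction[OF _ _ V.coaction_coef_B p(1)])
      (simp_all add: linear_iffs p.add p.scale V.coef_add V.coef_scale S.add S.scale distrib_left distrib_right
         mult_scale_left mult_scale_right)
  also have "\<dots> = lin_ext sH (\<lambda>(u, x). V.coef e u * S x) p"
    by (rule lin_ext_cong) (use p(2) \<pi>_on_W in auto)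
  also have "\<dots> = lin_ext sH (\<lambda>(u, x). V.coef e u * S x) (\<Sum>f\<in>B. Poly_Mapping.single (f, V.coef f w) 1)"
    by (rule V.bilinear_lin_ext_coaction[OF _ _ p(1) V.coaction_coef_B])
      (simp_all add: linear_iffs V.coef_add V.coef_scale S.add S.scale distrib_left distrib_right
         mult_scale_left mult_scale_right)
  also have "\<dots> = sH (V.coord e w) 1"
    by (simp add: lin_ext_sum_single vector_space_axioms V.antipode_coef_right_B)
  finally show "V.coord e (avg w) = V.coord e w"
    by (simp add: coord_avg e t.scale integral_one)
qed

text \<open>
  The kernel is taken inside a submodule \<open>U\<close>, as the induction on the dimension requires. If the
  average of \<open>u\<close> is zero, then subtracting the average from every first factor of an expression of
  \<open>\<rho>(u)\<close> does not change its class, by \<open>avg_coef\<close>, and moves the first factors into the kernel;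
  \<open>W \<subseteq> U\<close> keeps them in \<open>U\<close>.
\<close>

lemma kernel_hl_submodule:
  assumes U: "hl_submodule sV \<rho>V \<psi> U" "W \<subseteq> U"
  shows "hl_submodule sV \<rho>V \<psi> {u \<in> U. avg u = 0}"
proof -
  have sU: "V.V.subspace U" and aU: "\<And>a u. u \<in> U \<Longrightarrow> \<psi> a u \<in> U"
    using U by (auto simp: hl_submodule_def lie_submodule_def)
  have sub: "V.V.subspace {u \<in> U. avg u = 0}"
    using sU by (auto simp: V.V.subspace_def avg.add avg.scale avg.zero)
  have zero: "\<psi> a 0 = 0" for a
  proof -
    interpret act: Vector_Spaces.linear sV sV "\<psi> a" by (rule V.action_linear)
    show ?thesis by (rule act.zero)
  qed
  have lie: "lie_submodule sV \<psi> {u \<in> U. avg u = 0}"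
    using sub aU by (auto simp: lie_submodule_def avg_action zero)
  have "\<exists>p\<in>\<rho>V u. Poly_Mapping.keys p \<subseteq> {u \<in> U. avg u = 0} \<times> UNIV" if u: "u \<in> U" "avg u = 0" for u
  proof -
    obtain p where p: "p \<in> \<rho>V u" "Poly_Mapping.keys p \<subseteq> U \<times> UNIV"
      using U(1) u unfolding hl_submodule_def subcomodule_def by blast
    \<comment> \<open>With \<open>P\<close> for the average of \<open>\<pi>\<close>, \<open>q\<close> represents \<open>(P \<otimes> id)(\<rho>(u)) = \<rho>(P(u)) = 0\<close> and \<open>r\<close> represents
      \<open>\<rho>(u) - (P \<otimes> id)(\<rho>(u))\<close>.\<close>
    define q where "q = lin_ext fscale (\<lambda>(x, y). Poly_Mapping.single (avg x, y) 1) p"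
    define r where "r = lin_ext fscale (\<lambda>(x, y). Poly_Mapping.single (x - avg x, y) 1) p"
    have q_coef: "lin_ext sH (\<lambda>(x, y). sH (V.coord e x) y) q = 0" if e: "e \<in> B" for e
    proof -
      interpret l: Vector_Spaces.linear fscale sH "lin_ext sH (\<lambda>(x, y). sH (V.coord e x) y)"
        by (rule linear_lin_ext) (rule vector_space_axioms)
      have "lin_ext sH (\<lambda>(x, y). sH (V.coord e x) y) q = lin_ext sH (\<lambda>(x, y). sH (t (twisted e x)) y) p"
        unfolding q_def
        by (subst linear_comp_lin_ext[OF l.linear_axioms])
          (simp add: case_prod_unfold vector_space_axioms coord_avg e)
      also have "\<dots> = lin_ext sH (\<lambda>(x, y). sH (t (twisted e x)) y) (\<Sum>f\<in>B. Poly_Mapping.single (f, V.coef f u) 1)"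
        by (rule V.bilinear_lin_ext_coaction[OF _ _ p(1) V.coaction_coef_B])
          (simp_all add: linear_iffs twisted.add twisted.scale t.add t.scale scale_right_distrib scale_left_distrib mult.commute)
      also have "\<dots> = V.coef e (avg u)"
        by (simp add: lin_ext_sum_single vector_space_axioms avg_coef)
      also have "\<dots> = 0" using V.coef_scale[of e 0 0] u by simp
      finally show ?thesis .
    qed
    note [trans] = tensor_eq_trans[of sV sH]
    have "tensor_eq sV sH q (\<Sum>e\<in>B. Poly_Mapping.single (e, lin_ext sH (\<lambda>(x, y). sH (V.coord e x) y) q) 1)"
      by (rule tensor_eq_basis_expansion[OF V.V.vector_space_axioms vector_space_axioms V.finite_B V.coord_expansion_B])
    also have "\<dots> = (\<Sum>e\<in>B. Poly_Mapping.single (e, 0) 1)"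
      by (simp add: q_coef)
    also have "tensor_eq sV sH \<dots> (\<Sum>e\<in>B. 0)"
      by (intro tensor_eq_sum tensor_eq_single_zero_right)
    finally have q0: "tensor_eq sV sH q 0" by simp
    have "tensor_eq sV sH p (lin_ext fscale (\<lambda>(x, y). Poly_Mapping.single (x - avg x, y) 1 + Poly_Mapping.single (avg x, y) 1) p)"
      using tensor_eq_lin_ext[of p sV sH "\<lambda>k. Poly_Mapping.single k 1"]
        tensor_eq_single_add_left[of sV sH "x - avg x" "avg x" for x]
      by (subst (asm) lin_ext_single_id) (auto simp: case_prod_unfold)
    also have "\<dots> = r + q"
      by (simp add: r_def q_def lin_ext_def case_prod_unfold free.scale_right_distrib sum.distrib)
    also have "tensor_eq sV sH \<dots> (r + 0)"
      by (intro tensor_eq_add tensor_eq_refl q0)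
    finally have "tensor_eq sV sH r p" by (simp add: tensor_eq_sym)
    then have "r \<in> \<rho>V u" using tensor_space_mem_iff[OF V.coaction_tensor_space p(1)] by blast
    moreover have "Poly_Mapping.keys r \<subseteq> {u \<in> U. avg u = 0} \<times> UNIV"
    proof -
      have "Poly_Mapping.keys r \<subseteq> (\<Union>k\<in>Poly_Mapping.keys p. {(fst k - avg (fst k), snd k)})"
        unfolding r_def lin_ext_def
        by (rule order_trans[OF keys_sum]) (auto simp: in_keys_iff lookup_single when_def case_prod_unfold split: if_splits)
      moreover have "x - avg x \<in> {u \<in> U. avg u = 0}" if "x \<in> U" for x
        using that sU U(2) avg_in_W[of x] by (auto simp: avg.diff avg_on_W V.V.subspace_diff)
      ultimately show ?thesis using p(2) by fastforce
    qed
    ultimately show ?thesis by blast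
  qed
  then show ?thesis using lie sub by (auto simp: hl_submodule_def subcomodule_def)
qed

end

section \<open>Complements and the decomposition\<close>

context vector_space
begin

lemma subspace_set_plus: "subspace U \<Longrightarrow> subspace W \<Longrightarrow> subspace (U + W)"
proof -
  assume "subspace U" "subspace W"
  moreover have "U + W = {x + y | x y. x \<in> U \<and> y \<in> W}" by (auto simp: set_plus_def)
  ultimately show ?thesis using subspace_sums by simp
qed

lemma subset_set_plus_left: "subspace W \<Longrightarrow> U \<subseteq> U + W"
  using subspace_0 by (force simp: set_plus_def)

lemma subset_set_plus_right: "subspace U \<Longrightarrow> W \<subseteq> U + W"
  using subspace_0 by (force simp: set_plus_def)

end

context lie_representation
begin

lemma action_plus: "\<psi> a (u + v) = \<psi> a u + \<psi> a v"
  using action_linear by (simp add: Vector_Spaces.linear_iff)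

lemma action_zero: "\<psi> a 0 = 0"
  using action_plus[of a 0 0] by simp

lemma lie_submodule_set_plus:
  "lie_submodule sV \<psi> U \<Longrightarrow> lie_submodule sV \<psi> W \<Longrightarrow> lie_submodule sV \<psi> (U + W)"
  unfolding lie_submodule_def using V.subspace_set_plus
  by (auto simp: set_plus_def action_plus) blast

lemma lie_submodule_Int:
  "lie_submodule sV \<psi> U \<Longrightarrow> lie_submodule sV \<psi> W \<Longrightarrow> lie_submodule sV \<psi> (U \<inter> W)"
  unfolding lie_submodule_def using V.subspace_inter by blast

lemma lie_submodule_zero: "lie_submodule sV \<psi> {0}"
  by (simp add: lie_submodule_def V.subspace_single_0 action_zero)

text \<open>
  A submodule \<open>C\<close> of largest dimension among those with \<open>C \<inter> W = {0}\<close> is a complement: an irreducible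
  summand \<open>M\<close> outside \<open>C + W\<close> would meet \<open>C + W\<close> in zero, and \<open>C + M\<close> would be larger.
\<close>

lemma completely_reducible_complement:
  assumes fd: "finite_dimensional_vector_space sV B" and cr: "completely_reducible sV \<psi>"
    and W: "lie_submodule sV \<psi> W"
  obtains C where "lie_submodule sV \<psi> C" "C \<inter> W = {0}" "C + W = UNIV"
proof -
  interpret V: finite_dimensional_vector_space sV B by (rule fd)
  define P where "P C \<longleftrightarrow> lie_submodule sV \<psi> C \<and> C \<inter> W = {0}" for C
  have "0 \<in> W" using W V.subspace_0 by (simp add: lie_submodule_def)
  then have "P {0}" by (simp add: P_def lie_submodule_zero)
  moreover have "\<forall>C. P C \<longrightarrow> V.dim C < Suc (V.dim UNIV)"
    by (intro allI impI le_imp_less_Suc V.dim_subset subset_UNIV)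
  ultimately have "\<exists>C. P C \<and> (\<forall>D. P D \<longrightarrow> V.dim D \<le> V.dim C)"
    by (rule ex_has_greatest_nat)
  then obtain C where C: "P C" and max: "\<And>D. P D \<Longrightarrow> V.dim D \<le> V.dim C" by blast
  have subC: "V.subspace C" and subW: "V.subspace W" and lieC: "lie_submodule sV \<psi> C"
    using C W unfolding P_def lie_submodule_def by blast+
  let ?T = "C + W"
  have lieT: "lie_submodule sV \<psi> ?T"
    by (rule lie_submodule_set_plus[OF lieC W])
  obtain \<W> where sum: "is_direct_sum sV \<W> (\<lambda>W. W)"
    and irr: "\<And>M. M \<in> \<W> \<Longrightarrow> irreducible_lie_submodule sV \<psi> M"
    using cr unfolding completely_reducible_def by (elim exE conjE) simp
  have span: "V.span (\<Union>M\<in>\<W>. M) = UNIV" using sum by (simp only: is_direct_sum_def)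
  have "M \<subseteq> ?T" if "M \<in> \<W>" for M
  proof (rule ccontr)
    assume not_sub: "\<not> M \<subseteq> ?T"
    have lieM: "lie_submodule sV \<psi> M" using irr[OF that] by (simp add: irreducible_lie_submodule_def)
    have M0: "M \<inter> ?T = {0}"
      using irr[OF that] lie_submodule_Int[OF lieM lieT] not_sub
      unfolding irreducible_lie_submodule_def by blast
    have "(C + M) \<inter> W \<subseteq> {0}"
    proof
      fix w assume "w \<in> (C + M) \<inter> W"
      then obtain c m where cm: "c \<in> C" "m \<in> M" "w = c + m" "w \<in> W" by (auto simp: set_plus_def)
      have "- c + w \<in> ?T" by (rule set_plus_intro[OF V.subspace_neg[OF subC cm(1)] cm(4)])
      then have "m \<in> ?T" using cm(3) by simp
      then have "m = 0" using M0 cm by blast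
      then show "w \<in> {0}" using cm C by (auto simp: P_def)
    qed
    moreover have lieCM: "lie_submodule sV \<psi> ((C + M))" by (rule lie_submodule_set_plus[OF lieC lieM])
    ultimately have "P ((C + M))"
      using subW by (auto simp: P_def lie_submodule_def V.subspace_0)
    then have "C = (C + M)"
      using V.subspace_dim_equal[OF subC _ V.subset_set_plus_left] lieCM lieM max
      by (auto simp: lie_submodule_def)
    then have "M \<subseteq> ?T"
      using V.subset_set_plus_right[OF subC, of M] V.subset_set_plus_left[OF subW, of C] by simp
    then show False using not_sub by blast
  qed
  then have "V.span (\<Union>M\<in>\<W>. M) \<subseteq> ?T"
    using lieT by (intro V.span_minimal) (auto simp: lie_submodule_def)
  then show ?thesis using that[of C] C span by (auto simp: P_def)
qed

lemma equivariant_projection: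
  assumes W: "lie_submodule sV \<psi> W" and C: "lie_submodule sV \<psi> C" "C \<inter> W = {0}" "C + W = UNIV"
  obtains \<pi> where "Vector_Spaces.linear sV sV \<pi>" "\<And>v. \<pi> v \<in> W" "\<And>w. w \<in> W \<Longrightarrow> \<pi> w = w"
    "\<And>a v. \<pi> (\<psi> a v) = \<psi> a (\<pi> v)"
proof -
  have subC: "V.subspace C" and subW: "V.subspace W" using W C by (auto simp: lie_submodule_def)
  define \<pi> where "\<pi> v = (THE w. w \<in> W \<and> v - w \<in> C)" for v
  have uniq: "w = w'" if "w \<in> W" "v - w \<in> C" "w' \<in> W" "v - w' \<in> C" for v w w'
  proof -
    have "w - w' \<in> W" using that V.subspace_diff[OF subW] by blast
    moreover have "(v - w') - (v - w) \<in> C" using that V.subspace_diff[OF subC] by blast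
    ultimately have "w - w' \<in> C \<inter> W" by simp
    then show ?thesis using C(2) by simp
  qed
  have \<pi>_eq: "\<pi> v = w" if "w \<in> W" "v - w \<in> C" for v w
    unfolding \<pi>_def using that uniq by blast
  have ex: "\<exists>w. w \<in> W \<and> v - w \<in> C" for v
  proof -
    have "v \<in> (C + W)" using C(3) by simp
    then obtain c w where "v = c + w" "c \<in> C" "w \<in> W" by (auto simp: set_plus_def)
    then show ?thesis by (auto intro!: exI[of _ w])
  qed
  have \<pi>: "\<pi> v \<in> W" "v - \<pi> v \<in> C" for v using ex \<pi>_eq by metis+
  have lin: "Vector_Spaces.linear sV sV \<pi>"
  proof -
    have "\<pi> (u + v) = \<pi> u + \<pi> v" for u v
    proof (rule \<pi>_eq)
      show "\<pi> u + \<pi> v \<in> W" by (intro V.subspace_add[OF subW] \<pi>)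
      have "(u - \<pi> u) + (v - \<pi> v) \<in> C" by (intro V.subspace_add[OF subC] \<pi>)
      then show "u + v - (\<pi> u + \<pi> v) \<in> C" by (simp add: algebra_simps)
    qed
    moreover have "\<pi> (sV c v) = sV c (\<pi> v)" for c v
    proof (rule \<pi>_eq)
      show "sV c (\<pi> v) \<in> W" by (intro V.subspace_scale[OF subW] \<pi>)
      show "sV c v - sV c (\<pi> v) \<in> C"
        using V.subspace_scale[OF subC \<pi>(2)] by (simp add: V.scale_right_diff_distrib)
    qed
    ultimately show ?thesis by (simp add: Vector_Spaces.linear_iff V.vector_space_axioms)
  qed
  have "\<pi> w = w" if "w \<in> W" for w using \<pi>_eq[OF that, of w] V.subspace_0[OF subC] by simp
  moreover have "\<pi> (\<psi> a v) = \<psi> a (\<pi> v)" for a v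
  proof (rule \<pi>_eq)
    interpret act: Vector_Spaces.linear sV sV "\<psi> a" by (rule action_linear)
    show "\<psi> a (\<pi> v) \<in> W" using \<pi> W by (auto simp: lie_submodule_def)
    show "\<psi> a v - \<psi> a (\<pi> v) \<in> C" using \<pi>(2)[of v] C(1) by (auto simp: lie_submodule_def simp flip: act.diff)
  qed
  ultimately show ?thesis using that lin \<pi>(1) by blast
qed

end

context hl_module
begin

lemma hl_submodule_subspace: "hl_submodule sV \<rho>V \<psi> W \<Longrightarrow> V.V.subspace W"
  by (simp add: hl_submodule_def lie_submodule_def)

lemma hl_submodule_complement:
  assumes integral: "left_integral sH \<Delta> t" "ad_invariant \<Delta> \<epsilon> S t" "t 1 = 1"
    and fd: "finite_dimensional_vector_space sV B" and cr: "completely_reducible sV \<psi>"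
    and U: "hl_submodule sV \<rho>V \<psi> U" and W: "hl_submodule sV \<rho>V \<psi> W" "W \<subseteq> U"
  obtains U' where "hl_submodule sV \<rho>V \<psi> U'" "U' \<inter> W = {0}" "U' + W = U"
proof -
  interpret fd: finite_dimensional_vector_space sV B by (rule fd)
  have lieW: "lie_submodule sV \<psi> W" using W by (simp add: hl_submodule_def)
  obtain C where "lie_submodule sV \<psi> C" "C \<inter> W = {0}" "C + W = UNIV"
    using V.completely_reducible_complement[OF fd cr lieW] .
  then obtain \<pi> where \<pi>: "Vector_Spaces.linear sV sV \<pi>" "\<And>v. \<pi> v \<in> W" "\<And>w. w \<in> W \<Longrightarrow> \<pi> w = w"
    "\<And>a v. \<pi> (\<psi> a v) = \<psi> a (\<pi> v)"
    using V.equivariant_projection[OF lieW] by blast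
  define K where "K = L.extend_basis {}"
  have K: "L.independent K" "L.span K = UNIV"
    by (simp_all add: K_def L.independent_extend_basis L.span_extend_basis L.independent_empty)
  have V: "finite_hopf_comodule sH \<Delta> \<epsilon> S sV \<rho>V B"
    by (intro finite_hopf_comodule.intro finite_hopf_comodule_axioms.intro based_hopf_comodule.intro
        based_comodule.intro based_comodule_axioms.intro hopf_algebra_axioms V.comodule_axioms
        fd.independent_Basis fd.span_Basis fd.finite_Basis)
  have L: "based_hopf_comodule sH \<Delta> \<epsilon> S sL \<rho>L K"
    by (intro based_hopf_comodule.intro based_comodule.intro based_comodule_axioms.intro
        hopf_algebra_axioms L.comodule_axioms K)
  interpret A: integral_averaging sH \<Delta> \<epsilon> S sL br \<rho>L sV \<rho>V \<psi> B K t W \<pi>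
    by (intro integral_averaging.intro integral_averaging_axioms.intro hl_module_axioms V L integral W(1) \<pi>)
  define U' where "U' = {u \<in> U. A.avg u = 0}"
  have sub: "V.V.subspace U" "V.V.subspace W" using U W by (auto intro: hl_submodule_subspace)
  have "hl_submodule sV \<rho>V \<psi> U'"
    unfolding U'_def by (rule A.kernel_hl_submodule[OF U W(2)])
  moreover have "U' \<inter> W = {0}"
  proof -
    have "0 \<in> U'" "0 \<in> W" using sub V.V.subspace_0 by (auto simp: U'_def A.avg.zero)
    moreover have "w = 0" if "w \<in> U'" "w \<in> W" for w
      using that A.avg_on_W[OF that(2)] by (simp add: U'_def)
    ultimately show ?thesis by blast
  qed
  moreover have "U' + W = U"
  proof
    show "(U' + W) \<subseteq> U"
      using W(2) V.V.subspace_add[OF sub(1)] by (auto simp: set_plus_def U'_def subset_iff)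
    show "U \<subseteq> (U' + W)"
    proof
      fix u assume u: "u \<in> U"
      have "A.avg u \<in> U" using A.avg_in_W W(2) by blast
      then have "u - A.avg u \<in> U'"
        using u sub A.avg_in_W[of u] by (simp add: U'_def V.V.subspace_diff A.avg.diff A.avg_on_W)
      moreover have "u = (u - A.avg u) + A.avg u" by simp
      ultimately show "u \<in> (U' + W)"
        using A.avg_in_W[of u] unfolding set_plus_def by blast
    qed
  qed
  ultimately show ?thesis using that by blast
qed

text \<open>
  Split off a minimal nonzero submodule \<open>W\<close>, which is irreducible, and decompose its complement in \<open>U\<close>;
  \<open>W\<close> gets the last index.
\<close>

lemma hl_submodule_decomposition:
  assumes integral: "left_integral sH \<Delta> t" "ad_invariant \<Delta> \<epsilon> S t" "t 1 = 1"
    and fd: "finite_dimensional_vector_space sV B" and cr: "completely_reducible sV \<psi>"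
    and U: "hl_submodule sV \<rho>V \<psi> U"
  shows "\<exists>(s::nat) X. (\<forall>i\<in>{1..s}. irreducible_hl_submodule sV \<rho>V \<psi> (X i)) \<and>
     V.V.span (\<Union>i\<in>{1..s}. X i) = U \<and>
     (\<forall>i\<in>{1..s}. X i \<inter> V.V.span (\<Union>j\<in>{1..s} - {i}. X j) = {0})"
  using U
proof (induction "V.V.dim U" arbitrary: U rule: less_induct)
  case less
  interpret fd: finite_dimensional_vector_space sV B by (rule fd)
  have subU: "V.V.subspace U" using less.prems by (rule hl_submodule_subspace)
  show ?case
  proof (cases "U = {0}")
    case True
    then show ?thesis by (intro exI[of _ 0]) (auto simp: V.V.span_empty)
  next
    case False
    define P where "P W \<longleftrightarrow> hl_submodule sV \<rho>V \<psi> W \<and> W \<noteq> {0} \<and> W \<subseteq> U" for W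
    have "P U" using less.prems False by (simp add: P_def)
    then obtain W where W: "P W" and min: "\<And>X. P X \<Longrightarrow> V.V.dim W \<le> V.V.dim X"
      using ex_has_least_nat[of P U V.V.dim] by blast
    have hlW: "hl_submodule sV \<rho>V \<psi> W" "W \<noteq> {0}" "W \<subseteq> U" using W by (auto simp: P_def)
    have subW: "V.V.subspace W" using hlW(1) by (rule hl_submodule_subspace)
    have irrW: "irreducible_hl_submodule sV \<rho>V \<psi> W"
      unfolding irreducible_hl_submodule_def
    proof (intro conjI allI impI hlW)
      fix X assume X: "hl_submodule sV \<rho>V \<psi> X \<and> X \<subseteq> W"
      show "X = {0} \<or> X = W"
        using fd.subspace_dim_equal[OF hl_submodule_subspace subW, of X] X min[of X] hlW
        by (auto simp: P_def)
    qed
    obtain U' where U': "hl_submodule sV \<rho>V \<psi> U'" "U' \<inter> W = {0}" "U' + W = U"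
      using hl_submodule_complement[OF integral fd cr less.prems hlW(1,3)] .
    have subU': "V.V.subspace U'" using U'(1) by (rule hl_submodule_subspace)
    have "U' \<subseteq> U" using V.V.subset_set_plus_left[OF subW, of U'] U'(3) by simp
    moreover have "U' \<noteq> U" using hlW U'(2) by blast
    ultimately have "V.V.dim U' < V.V.dim U"
      using fd.subspace_dim_equal[OF subU' subU] by force
    from less.hyps[OF this U'(1)] obtain s :: nat and X where
      irr: "\<And>i. i \<in> {1..s} \<Longrightarrow> irreducible_hl_submodule sV \<rho>V \<psi> (X i)" and
      span: "V.V.span (\<Union>i\<in>{1..s}. X i) = U'" and
      indep: "\<And>i. i \<in> {1..s} \<Longrightarrow> X i \<inter> V.V.span (\<Union>j\<in>{1..s} - {i}. X j) = {0}"
      by blast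
    define Y where "Y = X(Suc s := W)"
    have un: "(\<Union>i\<in>I. Y i) = (\<Union>i\<in>I. X i)" if "I \<subseteq> {1..s}" for I
      using that by (auto simp: Y_def split: if_splits)
    have span_un: "V.V.span (A \<union> W) = V.V.span A + W" for A
      by (auto simp: V.V.span_Un set_plus_def V.V.span_eq_iff[THEN iffD2, OF subW])
    have top: "(\<Union>i\<in>{1..Suc s}. Y i) = (\<Union>i\<in>{1..s}. X i) \<union> W"
      using un[of "{1..s}"] by (auto simp: atLeastAtMostSuc_conv Y_def)
    have "V.V.span (\<Union>i\<in>{1..Suc s}. Y i) = U"
      unfolding top span_un span U'(3) ..
    moreover have "irreducible_hl_submodule sV \<rho>V \<psi> (Y i)" if "i \<in> {1..Suc s}" for i
      using that irr irrW by (auto simp: Y_def le_Suc_eq)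
    moreover have "Y i \<inter> V.V.span (\<Union>j\<in>{1..Suc s} - {i}. Y j) = {0}" if i: "i \<in> {1..Suc s}" for i
    proof (cases "i = Suc s")
      case True
      have "{1..Suc s} - {i} = {1..s}" using True by auto
      then show ?thesis using True U'(2) span un[of "{1..s}"] by (auto simp: Y_def)
    next
      case False
      then have i: "i \<in> {1..s}" using i by auto
      have "{1..Suc s} - {i} = insert (Suc s) ({1..s} - {i})" using i by auto
      then have "(\<Union>j\<in>{1..Suc s} - {i}. Y j) = Y (Suc s) \<union> (\<Union>j\<in>{1..s} - {i}. Y j)" by simp
      also have "\<dots> = (\<Union>j\<in>{1..s} - {i}. X j) \<union> W"
        unfolding un[OF Diff_subset] by (simp add: Y_def Un_commute)
      finally have sp: "V.V.span (\<Union>j\<in>{1..Suc s} - {i}. Y j)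
          = V.V.span (\<Union>j\<in>{1..s} - {i}. X j) + W"
        by (simp only: span_un)
      have "Y i \<inter> (V.V.span (\<Union>j\<in>{1..s} - {i}. X j) + W) \<subseteq> {0}"
      proof
        fix x assume "x \<in> Y i \<inter> (V.V.span (\<Union>j\<in>{1..s} - {i}. X j) + W)"
        then obtain y w where x: "x \<in> X i" "x = y + w" "y \<in> V.V.span (\<Union>j\<in>{1..s} - {i}. X j)" "w \<in> W"
          using i by (auto simp: Y_def set_plus_def)
        have "x \<in> U'" using x(1) i span V.V.span_superset[of "\<Union>i\<in>{1..s}. X i"] by blast
        moreover have "y \<in> U'"
          using x(3) span V.V.span_mono[of "\<Union>j\<in>{1..s} - {i}. X j" "\<Union>i\<in>{1..s}. X i"] by blast
        ultimately have "x - y \<in> U'" by (rule V.V.subspace_diff[OF subU'])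
        then have "w = 0" using x U'(2) by auto
        then show "x \<in> {0}" using x indep[OF i] by auto
      qed
      moreover have "0 \<in> Y i"
        using irr[OF i] i hl_submodule_subspace V.V.subspace_0 by (auto simp: Y_def irreducible_hl_submodule_def)
      moreover have "0 \<in> V.V.span (\<Union>j\<in>{1..Suc s} - {i}. Y j)" by (rule V.V.span_zero)
      ultimately show ?thesis unfolding sp by blast
    qed
    ultimately show ?thesis by (intro exI[of _ "Suc s"] exI[of _ Y]) blast
  qed
qed

end

theorem theorem8:
  fixes sH :: "'f::field_char_0 \<Rightarrow> 'h::ring_1 \<Rightarrow> 'h"
    and \<Delta> :: "'h \<Rightarrow> ('h \<times> 'h \<Rightarrow>\<^sub>0 'f) set"
    and \<epsilon> :: "'h \<Rightarrow> 'f"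
    and S :: "'h \<Rightarrow> 'h"
    and t :: "'h \<Rightarrow> 'f"
    and sL :: "'f \<Rightarrow> 'l::ab_group_add \<Rightarrow> 'l"
    and br :: "'l \<Rightarrow> 'l \<Rightarrow> 'l"
    and \<rho>L :: "'l \<Rightarrow> ('l \<times> 'h \<Rightarrow>\<^sub>0 'f) set"
    and sV :: "'f \<Rightarrow> 'v::ab_group_add \<Rightarrow> 'v"
    and \<rho>V :: "'v \<Rightarrow> ('v \<times> 'h \<Rightarrow>\<^sub>0 'f) set"
    and \<psi> :: "'l \<Rightarrow> 'v \<Rightarrow> 'v"
  assumes "hopf_algebra sH \<Delta> \<epsilon> S"
    and "left_integral sH \<Delta> t"
    and "ad_invariant \<Delta> \<epsilon> S t"
    and "t 1 = 1"
    and "comodule_lie_algebra sH \<Delta> \<epsilon> S sL br \<rho>L"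
    and "hl_module sH \<Delta> \<epsilon> S sL br \<rho>L sV \<rho>V \<psi>"
    and "\<exists>B. finite_dimensional_vector_space sV B"
    and "completely_reducible sV \<psi>"
  shows "\<exists>(s::nat) V. is_direct_sum sV {1..s} V \<and>
           (\<forall>i\<in>{1..s}. irreducible_hl_submodule sV \<rho>V \<psi> (V i))"
proof -
  interpret hl_module sH \<Delta> \<epsilon> S sL br \<rho>L sV \<rho>V \<psi> by fact
  obtain B where fd: "finite_dimensional_vector_space sV B" using assms(7) by blast
  have "\<exists>p. p \<in> \<rho>V v" for v
    using V.coaction_linear by (auto simp: tensor_linear_def intro: tensor_space_nonempty)
  then have "hl_submodule sV \<rho>V \<psi> UNIV"
    by (auto simp: hl_submodule_def lie_submodule_def subcomodule_def V.V.subspace_UNIV)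
  from hl_submodule_decomposition[OF assms(2-4) fd assms(8) this]
  obtain s :: nat and X where X: "\<forall>i\<in>{1..s}. irreducible_hl_submodule sV \<rho>V \<psi> (X i)"
    "V.V.span (\<Union>i\<in>{1..s}. X i) = UNIV"
    "\<forall>i\<in>{1..s}. X i \<inter> V.V.span (\<Union>j\<in>{1..s} - {i}. X j) = {0}" by blast
  then have "is_direct_sum sV {1..s} X"
    using hl_submodule_subspace by (auto simp: is_direct_sum_def irreducible_hl_submodule_def)
  then show ?thesis using X(1) by blast
qed

end
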